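(* Let $0<c_1<c_2$ be fixed constants. There is a constant $C$ (depending only on $c_1,c_2$) such that for every $\lambda\ge1$, every $f\in L^2(\mathbb{R}^2)$ with $\operatorname{supp}\widehat f\subset\{\xi\in\mathbb{R}^2: c_1\lambda\le|\xi|\le c_2\lambda\}$, and every interval $I\subset\mathbb{R}$ with $\lambda^{-2}\le|I|\le\lambda^{-1}$, $$\Big\|\sup_{t\in I}|e^{it\square}f(x)|\Big\|_{L^2(B(0,1))}\le C\,\lambda\,|I|^{1/2}\,\|f\|_{L^2(\mathbb{R}^2)}.$$
   Context: For $t\in\mathbb{R}$ the nonelliptic Schrödinger operator on $\mathbb{R}^2$ is $$e^{it\square}f(x):=\int_{\mathbb{R}^2}e^{i(x\cdot\xi+t\xi_1\xi_2)}\widehat f(\xi)\,d\xi,$$ where $\widehat f$ is the Fourier transform of $f$, normalized so that $e^{i0\square}f=f$, i.e. $\widehat f(\xi)=(2\pi)^{-2}\int_{\mathbb{R}^2}e^{-ix\cdot\xi}f(x)\,dx$. $|I|$ is the length of $I$, and $B(0,1)$ is the unit ball centered at the origin in $\mathbb{R}^2$. *)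

theory Defs
  imports "HOL-Analysis.Analysis"
begin

definition ennsqrt :: "ennreal \<Rightarrow> ennreal" where
  "ennsqrt a = (if a = \<infinity> then \<infinity> else ennreal (sqrt (enn2real a)))"

text \<open>The norm takes values in \<^typ>\<open>ennreal\<close>, so that a finite bound on it carries
  integrability instead of presupposing it.\<close>

definition L2norm :: "'a measure \<Rightarrow> ('a \<Rightarrow> ennreal) \<Rightarrow> ennreal" where
  "L2norm M h = ennsqrt (\<integral>\<^sup>+x. (h x)\<^sup>2 \<partial>M)"

definition L2 :: "(real^2 \<Rightarrow> complex) set" where
  "L2 = {f \<in> borel_measurable lebesgue. L2norm lebesgue (\<lambda>x. ennreal (norm (f x))) < \<infinity>}"

definition fourier_integral :: "(real^2 \<Rightarrow> complex) \<Rightarrow> real^2 \<Rightarrow> complex" where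
  "fourier_integral h \<xi> = (1 / (2 * pi)\<^sup>2) * (\<integral>x. exp (- (\<i> * (x \<bullet> \<xi>))) * h x \<partial>lebesgue)"

text \<open>For a function in \<^const>\<open>L2\<close> the Fourier integral need not converge; the transform is
  the limit in the mean of the transforms of the truncations to balls.\<close>

definition is_L2_fourier :: "(real^2 \<Rightarrow> complex) \<Rightarrow> (real^2 \<Rightarrow> complex) \<Rightarrow> bool" where
  "is_L2_fourier f g \<longleftrightarrow> g \<in> L2 \<and>
     ((\<lambda>R. L2norm lebesgue
         (\<lambda>\<xi>. ennreal (norm (g \<xi> - fourier_integral (\<lambda>x. indicator (cball 0 R) x * f x) \<xi>))))
       \<longlongrightarrow> 0) at_top"

text \<open>By Plancherel's theorem the limit exists for every \<open>f\<close> in \<^const>\<open>L2\<close>, so the value 0 is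
  only taken outside \<^const>\<open>L2\<close>. The limit is unique up to null sets, and neither
  the essential support nor the operator below depends on the representative chosen.\<close>

definition fourier :: "(real^2 \<Rightarrow> complex) \<Rightarrow> real^2 \<Rightarrow> complex" where
  "fourier f = (if \<exists>g. is_L2_fourier f g then SOME g. is_L2_fourier f g else (\<lambda>_. 0))"

text \<open>The support of an almost-everywhere class: the complement of the largest open set on which
  the function vanishes almost everywhere.\<close>

definition ess_supp :: "(real^2 \<Rightarrow> complex) \<Rightarrow> (real^2) set" where
  "ess_supp g = - \<Union>{U. open U \<and> (AE \<xi> in lebesgue. \<xi> \<in> U \<longrightarrow> g \<xi> = 0)}"

text \<open>The integral converges absolutely when the transform, being in \<^const>\<open>L2\<close>, has bounded
  support.\<close>

definition schroedinger :: "real \<Rightarrow> (real^2 \<Rightarrow> complex) \<Rightarrow> real^2 \<Rightarrow> complex" where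
  "schroedinger t f x =
     (\<integral>\<xi>. exp (\<i> * (x \<bullet> \<xi> + t * (\<xi>$1) * (\<xi>$2))) * fourier f \<xi> \<partial>lebesgue)"

end

theory Submission
  imports Defs "HOL-Probability.Characteristic_Functions"
begin

text \<open>
  The estimate is a Sobolev embedding in time combined with Plancherel's theorem in space. Write
  \<open>S\<^sub>t\<close> for \<^const>\<open>schroedinger\<close> applied to \<open>f\<close> at time \<open>t\<close> and \<open>D\<^sub>t\<close> for its time derivative.
  On the Fourier side \<open>D\<^sub>t\<close> arises from \<open>S\<^sub>t\<close> by multiplication with \<open>\<i> \<xi>\<^sub>1 \<xi>\<^sub>2\<close>, and
  \<open>\<bar>\<xi>\<^sub>1 \<xi>\<^sub>2\<bar> \<le> M = (c\<^sub>2 \<lambda>)\<^sup>2 / 2\<close> on the frequency support. Fix \<open>s \<in> I\<close>. At every point \<open>x\<close> and for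
  every \<open>t \<in> I\<close> the fundamental theorem of calculus for \<open>\<bar>S\<^sub>r(x)\<bar>\<^sup>2\<close> gives
  \<open>\<bar>S\<^sub>t(x)\<bar>\<^sup>2 \<le> \<bar>S\<^sub>s(x)\<bar>\<^sup>2 + \<integral>\<^sub>I 2 \<bar>S\<^sub>r(x)\<bar> \<bar>D\<^sub>r(x)\<bar> dr \<le> \<bar>S\<^sub>s(x)\<bar>\<^sup>2 + \<integral>\<^sub>I (M \<bar>S\<^sub>r(x)\<bar>\<^sup>2 + \<bar>D\<^sub>r(x)\<bar>\<^sup>2 / M) dr\<close>.
  The right-hand side does not depend on \<open>t\<close>, so it bounds the square of the supremum. Integrated
  over all \<open>x\<close>, each of \<open>\<bar>S\<^sub>s\<bar>\<^sup>2\<close>, \<open>\<bar>S\<^sub>r\<bar>\<^sup>2\<close> and \<open>\<bar>D\<^sub>r\<bar>\<^sup>2 / M\<^sup>2\<close> contributes at most a constant times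
  \<open>\<parallel>f\<parallel>\<^sup>2\<close>, whence the total is at most a constant times \<open>(1 + 2 M \<bar>I\<bar>) \<parallel>f\<parallel>\<^sup>2\<close>. Since
  \<open>1 \<le> \<lambda>\<^sup>2 \<bar>I\<bar>\<close>, this is of the order \<open>\<lambda>\<^sup>2 \<bar>I\<bar> \<parallel>f\<parallel>\<^sup>2\<close>. This is \<open>maximal_inequality\<close>, for a
  general real phase, and \<open>schroedinger_maximal\<close>, for the phase \<open>\<xi>\<^sub>1 \<xi>\<^sub>2\<close>.

  Plancherel's theorem enters as an inequality for integrable functions
  (\<open>plancherel_inequality\<close>), which is used twice: in space, to bound \<open>S\<^sub>r\<close> and \<open>D\<^sub>r\<close> by the
  transform of \<open>f\<close>, and in frequency, to bound that transform, a limit in the mean of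
  Fourier integrals of truncations, by \<open>f\<close> itself (\<open>L2_fourier_bound\<close>). To prove it, insert a
  Gaussian weight: the weighted integral of the squared modulus then becomes a quadratic form
  whose kernel is a nonnegative Gaussian of total mass \<open>(2\<pi>)\<^sup>n\<close>. Schur's test bounds
  the form by its mass, uniformly in the width of the weight, and Fatou's lemma removes the weight.
\<close>

section \<open>The Fourier transform of a Gaussian\<close>

text \<open>The substitution \<open>x = \<sigma> y\<close> reduces this to the characteristic function of the standard normal
  distribution. The answer is written as a multiple of a normal density, so that its nonnegativity
  and its mass \<open>2\<pi>\<close>, which Schur's test needs, come for free.\<close>

lemma fourier_gaussian_real:
  fixes \<sigma> u :: real
  assumes "0 < \<sigma>"
  shows "(CLBINT x. iexp (u * x) * complex_of_real (exp (- x\<^sup>2 / (2 * \<sigma>\<^sup>2))))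
    = complex_of_real (2 * pi * normal_density 0 (1 / \<sigma>) u)"
proof -
  have std: "(CLBINT x. iexp (v * x) * complex_of_real (std_normal_density x)) = exp (- v\<^sup>2 / 2)" for v
  proof -
    have "char std_normal_distribution v = (CLBINT x. iexp (v * x) * complex_of_real (std_normal_density x))"
      unfolding char_def 
      by (subst integral_density) (auto simp: scaleR_conv_of_real mult.commute)
    then show ?thesis by (simp add: char_std_normal_distribution)
  qed
  have "(CLBINT x. iexp (u * x) * complex_of_real (exp (- x\<^sup>2 / (2 * \<sigma>\<^sup>2))))
      = \<sigma> *\<^sub>R (CLBINT x. iexp (u * (0 + \<sigma> * x)) * complex_of_real (exp (- (0 + \<sigma> * x)\<^sup>2 / (2 * \<sigma>\<^sup>2))))"
    using assms by (subst lborel_integral_real_affine[where c = \<sigma> and t = 0]) auto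
  also have "(\<lambda>x. iexp (u * (0 + \<sigma> * x)) * complex_of_real (exp (- (0 + \<sigma> * x)\<^sup>2 / (2 * \<sigma>\<^sup>2))))
      = (\<lambda>x. complex_of_real (sqrt (2 * pi)) * (iexp ((u * \<sigma>) * x) * complex_of_real (std_normal_density x)))"
    using assms by (auto simp: fun_eq_iff std_normal_density_def power_mult_distrib mult_ac)
  also have "\<sigma> *\<^sub>R (CLBINT x. complex_of_real (sqrt (2 * pi)) * (iexp ((u * \<sigma>) * x) * complex_of_real (std_normal_density x)))
      = complex_of_real (\<sigma> * sqrt (2 * pi) * exp (- (u * \<sigma>)\<^sup>2 / 2))"
    by (subst integral_mult_right_zero, subst std) (simp add: scaleR_conv_of_real)
  also have "\<sigma> * sqrt (2 * pi) * exp (- (u * \<sigma>)\<^sup>2 / 2) = 2 * pi * normal_density 0 (1 / \<sigma>) u"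
  proof -
    have "sqrt (2 * pi) * sqrt (2 * pi) = 2 * pi" by simp
    then have "\<sigma> * sqrt (2 * pi) = 2 * pi / sqrt (2 * pi / \<sigma>\<^sup>2)"
      using assms by (simp add: real_sqrt_divide field_simps)
    then show ?thesis
      using assms by (simp add: normal_density_def power_divide power_mult_distrib mult_ac)
  qed
  finally show ?thesis .
qed

lemma integral_lborel_prod:
  fixes f :: "'a::euclidean_space \<Rightarrow> real \<Rightarrow> 'b::{real_normed_field, banach, second_countable_topology}"
  assumes f: "\<And>b. b \<in> Basis \<Longrightarrow> integrable lborel (f b)"
  shows "(\<integral>x. (\<Prod>b\<in>Basis. f b (x \<bullet> b)) \<partial>lborel) = (\<Prod>b\<in>Basis. \<integral>x. f b x \<partial>lborel)"
proof -
  interpret product_sigma_finite "\<lambda>_::'a. lborel :: real measure" ..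
  have [measurable]: "f b \<in> borel_measurable borel" if "b \<in> Basis" for b
    using borel_measurable_integrable[OF f[OF that]] by simp
  have "(\<integral>x. (\<Prod>b\<in>Basis. f b (x \<bullet> b)) \<partial>lborel)
      = (\<integral>y. (\<Prod>b\<in>Basis. f b (y b)) \<partial>(\<Pi>\<^sub>M b\<in>(Basis::'a set). lborel))"
    by (subst lborel_eq, subst integral_distr)
       (auto simp: inner_sum_left_Basis cong: prod.cong)
  also have "\<dots> = (\<Prod>b\<in>Basis. \<integral>x. f b x \<partial>lborel)"
    by (rule product_integral_prod) (auto intro: f)
  finally show ?thesis .
qed

definition gaussian :: "real \<Rightarrow> 'a::euclidean_space \<Rightarrow> real" where
  "gaussian \<sigma> x = exp (- (norm x)\<^sup>2 / (2 * \<sigma>\<^sup>2))"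

text \<open>The Fourier transform of \<open>gaussian \<sigma>\<close>: up to constants a product of normal densities
  of standard deviation \<open>1 / \<sigma>\<close> in the coordinates.\<close>

definition gaussian_transform :: "real \<Rightarrow> 'a::euclidean_space \<Rightarrow> real" where
  "gaussian_transform \<sigma> u = (\<Prod>b\<in>Basis. 2 * pi * normal_density 0 (1 / \<sigma>) (u \<bullet> b))"

lemma gaussian_eq_prod: "gaussian \<sigma> x = (\<Prod>b\<in>Basis. exp (- (x \<bullet> b)\<^sup>2 / (2 * \<sigma>\<^sup>2)))"
proof -
  have "(norm x)\<^sup>2 = (\<Sum>b\<in>Basis. (x \<bullet> b)\<^sup>2)"
    by (simp only: power2_norm_eq_inner euclidean_inner[of x x]) (simp add: power2_eq_square)
  then show ?thesis
    by (simp add: gaussian_def exp_sum[symmetric] sum_negf sum_divide_distrib)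
qed

lemma integrable_gaussian_real:
  assumes "0 < (\<sigma>::real)"
  shows "integrable lborel (\<lambda>x. exp (- x\<^sup>2 / (2 * \<sigma>\<^sup>2)))"
proof -
  have "(\<lambda>x. exp (- x\<^sup>2 / (2 * \<sigma>\<^sup>2))) = (\<lambda>x. sqrt (2 * pi * \<sigma>\<^sup>2) * normal_density 0 \<sigma> x)"
    using assms by (auto simp: normal_density_def)
  then show ?thesis
    using integrable_normal_density[OF assms, of 0] by simp
qed

text \<open>Both the Gaussian and the exponential split into factors of one coordinate each.\<close>

lemma fourier_gaussian:
  assumes "0 < \<sigma>"
  shows "(\<integral>x. iexp (u \<bullet> x) * complex_of_real (gaussian \<sigma> x) \<partial>lborel)
    = complex_of_real (gaussian_transform \<sigma> u)"
proof -
  let ?f = "\<lambda>b x. iexp ((u \<bullet> b) * x) * complex_of_real (exp (- x\<^sup>2 / (2 * \<sigma>\<^sup>2)))"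
  have "(\<lambda>x. iexp (u \<bullet> x) * complex_of_real (gaussian \<sigma> x)) = (\<lambda>x. \<Prod>b\<in>Basis. ?f b (x \<bullet> b))"
  proof
    fix x
    have "iexp (u \<bullet> x) = (\<Prod>b\<in>Basis. iexp ((u \<bullet> b) * (x \<bullet> b)))"
      by (subst euclidean_inner) (simp add: sum_distrib_left exp_sum)
    then show "iexp (u \<bullet> x) * complex_of_real (gaussian \<sigma> x) = (\<Prod>b\<in>Basis. ?f b (x \<bullet> b))"
      by (simp only: gaussian_eq_prod prod.distrib of_real_prod)
  qed
  moreover have "integrable lborel (?f b)" for b
    by (rule Bochner_Integration.integrable_bound[OF integrable_gaussian_real[OF assms]]) (auto simp: norm_mult)
  ultimately have "(\<integral>x. iexp (u \<bullet> x) * complex_of_real (gaussian \<sigma> x) \<partial>lborel)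
      = (\<Prod>b\<in>Basis. CLBINT x. ?f b x)"
    using integral_lborel_prod[where f = ?f] by (simp only:)
  then show ?thesis
    by (simp only: fourier_gaussian_real[OF assms] gaussian_transform_def of_real_prod)
qed

lemma gaussian_measurable [measurable]: "gaussian \<sigma> \<in> borel_measurable borel"
  unfolding gaussian_def[abs_def] by measurable

lemma gaussian_transform_measurable [measurable]: "gaussian_transform \<sigma> \<in> borel_measurable borel"
  unfolding gaussian_transform_def[abs_def] by measurable

lemma gaussian_transform_nonneg: "0 \<le> gaussian_transform \<sigma> u"
  by (simp add: gaussian_transform_def prod_nonneg)

lemma integrable_gaussian:
  assumes "0 < \<sigma>"
  shows "integrable lborel (gaussian \<sigma> :: 'a::euclidean_space \<Rightarrow> real)"
proof -
  have "(\<integral>\<^sup>+(x::'a). gaussian \<sigma> x \<partial>lborel) = (\<Prod>b\<in>(Basis::'a set). \<integral>\<^sup>+x. exp (- x\<^sup>2 / (2 * \<sigma>\<^sup>2)) \<partial>lborel)"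
    by (subst nn_integral_lborel_prod[symmetric]) (auto simp: gaussian_eq_prod prod_ennreal)
  also have "\<dots> < \<infinity>"
    using nn_integral_eq_integral[OF integrable_gaussian_real[OF assms]]
    by (simp add: ennreal_power)
  finally show ?thesis
    by (intro integrableI_nonneg) (auto simp: gaussian_def)
qed

lemma nn_integral_gaussian_transform:
  assumes "0 < \<sigma>"
  shows "(\<integral>\<^sup>+(u::'a::euclidean_space). gaussian_transform \<sigma> u \<partial>lborel) = ennreal ((2 * pi) ^ DIM('a))"
proof -
  have "(\<integral>\<^sup>+v. 2 * pi * normal_density 0 (1 / \<sigma>) v \<partial>lborel) = ennreal (2 * pi)"
    using assms by (subst nn_integral_eq_integral) auto
  moreover have "(\<integral>\<^sup>+(u::'a). gaussian_transform \<sigma> u \<partial>lborel)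
     = (\<Prod>b\<in>(Basis::'a set). \<integral>\<^sup>+v. 2 * pi * normal_density 0 (1 / \<sigma>) v \<partial>lborel)"
    by (subst nn_integral_lborel_prod[symmetric])
       (auto simp: gaussian_transform_def prod_ennreal)
  ultimately show ?thesis
    by (simp add: ennreal_power)
qed

section \<open>Integration over Euclidean space and Schur's test\<close>

lemma nn_integral_lborel_shift:
  fixes t :: "'a::euclidean_space"
  assumes [measurable]: "f \<in> borel_measurable borel"
  shows "(\<integral>\<^sup>+x. f (x - t) \<partial>lborel) = (\<integral>\<^sup>+x. f x \<partial>lborel)"
proof -
  have "(\<integral>\<^sup>+x. f x \<partial>lborel) = (\<integral>\<^sup>+x. f x \<partial>distr lborel borel ((+) (- t)))"
    by (simp add: lborel_distr_plus)
  also have "\<dots> = (\<integral>\<^sup>+x. f (x - t) \<partial>lborel)"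
    by (subst nn_integral_distr) auto
  finally show ?thesis by simp
qed

lemma nn_integral_lborel_reflect:
  fixes t :: "'a::euclidean_space"
  assumes [measurable]: "f \<in> borel_measurable borel"
  shows "(\<integral>\<^sup>+x. f (t - x) \<partial>lborel) = (\<integral>\<^sup>+x. f x \<partial>lborel)"
proof -
  have "(\<integral>\<^sup>+x. f x \<partial>lborel) = (\<integral>\<^sup>+x. f x \<partial>density (distr lborel borel (\<lambda>x. t + (-1) *\<^sub>R x)) (\<lambda>_. ennreal (\<bar>- 1\<bar> ^ DIM('a))))"
    by (subst lborel_affine[of "- 1" t]) auto
  also have "\<dots> = (\<integral>\<^sup>+x. f (t - x) \<partial>lborel)"
    by (simp add: density_1 nn_integral_distr)
  finally show ?thesis by simp
qed

lemma norm_integral_le_nn_integral: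
  fixes f :: "'a \<Rightarrow> 'b::{banach, second_countable_topology}"
  shows "ennreal (norm (\<integral>x. f x \<partial>M)) \<le> (\<integral>\<^sup>+x. ennreal (norm (f x)) \<partial>M)"
  by (cases "integrable M f") (auto intro: integral_norm_bound_ennreal simp: not_integrable_integral_eq)

text \<open>By \<open>2 h(x) h(y) \<le> h(x)\<^sup>2 + h(y)\<^sup>2\<close> the double integral splits into two, in each of which one
  variable occurs in \<open>K\<close> only and can be integrated out by translation invariance.\<close>

lemma schur_test_convolution:
  fixes h K :: "'a::euclidean_space \<Rightarrow> real"
  assumes [measurable]: "h \<in> borel_measurable borel" "K \<in> borel_measurable borel"
    and nonneg: "\<And>x. 0 \<le> h x" "\<And>x. 0 \<le> K x"
  shows "(\<integral>\<^sup>+x. \<integral>\<^sup>+y. ennreal (h x * h y * K (x - y)) \<partial>lborel \<partial>lborel)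
    \<le> (\<integral>\<^sup>+x. ennreal (K x) \<partial>lborel) * (\<integral>\<^sup>+x. ennreal ((h x)\<^sup>2) \<partial>lborel)"
proof -
  let ?c = "\<integral>\<^sup>+x. ennreal (K x) \<partial>lborel" and ?q = "\<lambda>x. ennreal ((h x)\<^sup>2 / 2)"
  have "ennreal (h x * h y * K (x - y)) \<le> ?q x * K (x - y) + ?q y * K (x - y)" for x y
  proof -
    have "0 \<le> (h x - h y)\<^sup>2" by simp
    then have "h x * h y \<le> (h x)\<^sup>2 / 2 + (h y)\<^sup>2 / 2"
      unfolding power2_diff by (simp add: field_simps)
    then have "h x * h y * K (x - y) \<le> ((h x)\<^sup>2 / 2 + (h y)\<^sup>2 / 2) * K (x - y)"
      by (intro mult_right_mono nonneg)
    then show ?thesis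
      using nonneg by (simp add: ennreal_mult[symmetric] ennreal_plus[symmetric] distrib_right del: ennreal_plus)
  qed
  then have "(\<integral>\<^sup>+x. \<integral>\<^sup>+y. ennreal (h x * h y * K (x - y)) \<partial>lborel \<partial>lborel)
      \<le> (\<integral>\<^sup>+x. \<integral>\<^sup>+y. ?q x * K (x - y) + ?q y * K (x - y) \<partial>lborel \<partial>lborel)"
    by (intro nn_integral_mono)
  also have "\<dots> = (\<integral>\<^sup>+x. \<integral>\<^sup>+y. ?q x * K (x - y) \<partial>lborel \<partial>lborel)
      + (\<integral>\<^sup>+x. \<integral>\<^sup>+y. ?q y * K (x - y) \<partial>lborel \<partial>lborel)"
    by (simp add: nn_integral_add)
  also have "(\<integral>\<^sup>+x. \<integral>\<^sup>+y. ?q y * K (x - y) \<partial>lborel \<partial>lborel)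
      = (\<integral>\<^sup>+y. \<integral>\<^sup>+x. ?q y * K (x - y) \<partial>lborel \<partial>lborel)"
    by (rule lborel_pair.Fubini') measurable
  also have "(\<integral>\<^sup>+y. \<integral>\<^sup>+x. ?q y * K (x - y) \<partial>lborel \<partial>lborel) = (\<integral>\<^sup>+y. ?q y \<partial>lborel) * ?c"
    by (simp add: nn_integral_cmult nn_integral_multc nn_integral_lborel_shift[where f = "\<lambda>x. ennreal (K x)"])
  also have "(\<integral>\<^sup>+x. \<integral>\<^sup>+y. ?q x * K (x - y) \<partial>lborel \<partial>lborel) = (\<integral>\<^sup>+y. ?q y \<partial>lborel) * ?c"
    by (simp add: nn_integral_cmult nn_integral_multc nn_integral_lborel_reflect[where f = "\<lambda>x. ennreal (K x)"])
  also have "(\<integral>\<^sup>+y. ?q y \<partial>lborel) * ?c + (\<integral>\<^sup>+y. ?q y \<partial>lborel) * ?c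
      = ?c * (\<integral>\<^sup>+y. ?q y + ?q y \<partial>lborel)"
    by (simp add: nn_integral_add distrib_left mult.commute)
  also have "(\<lambda>y. ?q y + ?q y) = (\<lambda>y. ennreal ((h y)\<^sup>2))"
    by (simp add: fun_eq_iff ennreal_plus[symmetric] del: ennreal_plus)
  finally show ?thesis .
qed

section \<open>The Plancherel inequality\<close>

text \<open>A bounded kernel leaves the tensor product \<open>a(x) b(y)\<close> integrable, so the order of
  integration can be exchanged.\<close>

lemma Fubini_bounded_kernel:
  fixes a b :: "'a::euclidean_space \<Rightarrow> complex"
  assumes a: "integrable lborel a" and b: "integrable lborel b"
    and E: "case_prod E \<in> borel_measurable (lborel \<Otimes>\<^sub>M lborel)" "\<And>x y. norm (E x y) \<le> 1"
  shows "(\<integral>x. a x * (\<integral>y. E x y * b y \<partial>lborel) \<partial>lborel) = (\<integral>y. b y * (\<integral>x. E x y * a x \<partial>lborel) \<partial>lborel)"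
proof -
  have [measurable]: "a \<in> borel_measurable borel" "b \<in> borel_measurable borel"
    using a b by auto
  note E(1)[measurable]
  let ?F = "\<lambda>x y. a x * (E x y * b y)"
  have meas: "case_prod ?F \<in> borel_measurable (lborel \<Otimes>\<^sub>M lborel)"
    by measurable
  have dom: "integrable (lborel \<Otimes>\<^sub>M lborel) (\<lambda>(x, y). norm (a x) * norm (b y))"
    using a b by (intro lborel_pair.Fubini_integrable) (auto simp: norm_mult)
  have "integrable (lborel \<Otimes>\<^sub>M lborel) (case_prod ?F)"
  proof (rule Bochner_Integration.integrable_bound[OF dom meas], rule AE_I2)
    fix p :: "'a \<times> 'a"
    obtain x y where p: "p = (x, y)" by force
    have "norm (E x y) * (norm (a x) * norm (b y)) \<le> 1 * (norm (a x) * norm (b y))"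
      using E(2) by (intro mult_right_mono) auto
    then show "norm (case_prod ?F p) \<le> norm (case p of (x, y) \<Rightarrow> norm (a x) * norm (b y))"
      by (simp add: p norm_mult mult_ac)
  qed
  from lborel_pair.Fubini_integral[OF this]
  have "(\<integral>x. (\<integral>y. ?F x y \<partial>lborel) \<partial>lborel) = (\<integral>y. (\<integral>x. ?F x y \<partial>lborel) \<partial>lborel)"
    by simp
  moreover have "(\<integral>x. ?F x y \<partial>lborel) = b y * (\<integral>x. E x y * a x \<partial>lborel)" for y
    by (simp add: mult_ac flip: integral_mult_right_zero)
  ultimately show ?thesis by simp
qed

text \<open>The inverse Fourier integral in the normalization that carries no constant.\<close>

definition fourier_synthesis :: "('a::euclidean_space \<Rightarrow> complex) \<Rightarrow> 'a \<Rightarrow> complex" where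
  "fourier_synthesis h x = (\<integral>\<xi>. iexp (x \<bullet> \<xi>) * h \<xi> \<partial>lborel)"

lemma fourier_synthesis_measurable [measurable]:
  assumes [measurable]: "h \<in> borel_measurable borel"
  shows "fourier_synthesis h \<in> borel_measurable borel"
  unfolding fourier_synthesis_def[abs_def] by measurable

lemma norm_fourier_synthesis_le: "norm (fourier_synthesis h x) \<le> (\<integral>\<xi>. norm (h \<xi>) \<partial>lborel)"
  unfolding fourier_synthesis_def by (rule integral_norm_bound[THEN order_trans]) (simp add: norm_mult)

lemma integrable_gaussian_mult_bounded:
  fixes H :: "'a::euclidean_space \<Rightarrow> 'b::{real_normed_algebra_1, second_countable_topology, banach}"
  assumes "0 < \<sigma>" "H \<in> borel_measurable borel" "\<And>x. norm (H x) \<le> B"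
  shows "integrable lborel (\<lambda>x. gaussian \<sigma> x *\<^sub>R H x)"
proof (rule Bochner_Integration.integrable_bound[where f = "\<lambda>x. B * gaussian \<sigma> x"])
  show "integrable lborel (\<lambda>x::'a. B * gaussian \<sigma> x)"
    using integrable_gaussian[OF assms(1), where 'a = 'a] by simp
  show "(\<lambda>x. gaussian \<sigma> x *\<^sub>R H x) \<in> borel_measurable lborel"
    using assms(2) by measurable
  have "B \<ge> 0" using assms(3)[of 0] norm_ge_zero order_trans by blast
  then show "AE x in lborel. norm (gaussian \<sigma> x *\<^sub>R H x) \<le> norm (B * gaussian \<sigma> x)"
    using assms(3) by (auto simp: gaussian_def mult.commute intro!: mult_right_mono)
qed

text \<open>Fubini turns the left-hand side into the quadratic form with kernel
  \<open>gaussian_transform \<sigma> (\<xi> - \<eta>)\<close>. Its mass does not depend on \<open>\<sigma>\<close>, so Schur's test gives a bound uniform in \<open>\<sigma>\<close>.\<close>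

lemma gaussian_plancherel:
  fixes h :: "'a::euclidean_space \<Rightarrow> complex"
  assumes h: "integrable lborel h" and \<sigma>: "0 < \<sigma>"
  shows "(\<integral>\<^sup>+x. ennreal (gaussian \<sigma> x * (norm (fourier_synthesis h x))\<^sup>2) \<partial>lborel)
    \<le> ennreal ((2 * pi) ^ DIM('a)) * (\<integral>\<^sup>+\<xi>. ennreal ((norm (h \<xi>))\<^sup>2) \<partial>lborel)"
proof -
  let ?H = "fourier_synthesis h" and ?B = "\<integral>\<xi>. norm (h \<xi>) \<partial>lborel"
  \<comment> \<open>The weight goes to the conjugate factor, which makes that factor integrable; Fubini then applies
    to one factor after the other.\<close>
  define \<Phi> where "\<Phi> = (\<lambda>x. gaussian \<sigma> x *\<^sub>R cnj (?H x))"
  have [measurable]: "h \<in> borel_measurable borel" using h by auto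
  have [measurable]: "(\<lambda>x. cnj (?H x)) \<in> borel_measurable borel"
    by (rule borel_measurable_continuous_on[OF continuous_on_cnj[OF continuous_on_id]]) measurable
  have int_\<Phi>: "integrable lborel \<Phi>"
    unfolding \<Phi>_def by (rule integrable_gaussian_mult_bounded[OF \<sigma>, where B = ?B]) (auto simp: norm_fourier_synthesis_le)
  have kernel: "(\<lambda>(x, \<xi>). iexp (x \<bullet> \<xi>)) \<in> borel_measurable ((lborel :: 'a measure) \<Otimes>\<^sub>M lborel)"
    by measurable
  have inner: "(\<integral>x. iexp (x \<bullet> \<xi>) * \<Phi> x \<partial>lborel)
      = (\<integral>\<eta>. cnj (h \<eta>) * complex_of_real (gaussian_transform \<sigma> (\<xi> - \<eta>)) \<partial>lborel)" for \<xi>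
  proof -
    have w: "integrable lborel (\<lambda>x. gaussian \<sigma> x *\<^sub>R iexp (x \<bullet> \<xi>))"
      by (rule integrable_gaussian_mult_bounded[OF \<sigma>, where B = 1]) auto
    have "cnj (?H x) = (\<integral>\<eta>. iexp (- (x \<bullet> \<eta>)) * cnj (h \<eta>) \<partial>lborel)" for x
      unfolding fourier_synthesis_def by (subst Bochner_Integration.integral_cnj[symmetric]) (simp add: exp_cnj)
    then have "(\<integral>x. iexp (x \<bullet> \<xi>) * \<Phi> x \<partial>lborel)
        = (\<integral>x. (gaussian \<sigma> x *\<^sub>R iexp (x \<bullet> \<xi>)) * (\<integral>\<eta>. iexp (- (x \<bullet> \<eta>)) * cnj (h \<eta>) \<partial>lborel) \<partial>lborel)"
      by (simp add: \<Phi>_def scaleR_conv_of_real mult_ac)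
    also have "\<dots> = (\<integral>\<eta>. cnj (h \<eta>) * (\<integral>x. iexp (- (x \<bullet> \<eta>)) * (gaussian \<sigma> x *\<^sub>R iexp (x \<bullet> \<xi>)) \<partial>lborel) \<partial>lborel)"
      using h by (intro Fubini_bounded_kernel w) auto
    moreover have "(\<integral>x. iexp (- (x \<bullet> \<eta>)) * (gaussian \<sigma> x *\<^sub>R iexp (x \<bullet> \<xi>)) \<partial>lborel)
        = complex_of_real (gaussian_transform \<sigma> (\<xi> - \<eta>))" for \<eta>
    proof -
      have "iexp (- (x \<bullet> \<eta>)) * iexp (x \<bullet> \<xi>) = iexp ((\<xi> - \<eta>) \<bullet> x)" for x
        unfolding exp_add[symmetric] by (simp add: inner_diff_left inner_commute algebra_simps)
      then have "iexp (- (x \<bullet> \<eta>)) * (gaussian \<sigma> x *\<^sub>R iexp (x \<bullet> \<xi>))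
          = iexp ((\<xi> - \<eta>) \<bullet> x) * complex_of_real (gaussian \<sigma> x)" for x
        unfolding scaleR_conv_of_real by (metis mult.assoc mult.commute)
      then show ?thesis
        by (simp only: fourier_gaussian[OF \<sigma>])
    qed
    ultimately show ?thesis by (simp only:)
  qed
  have int: "integrable lborel (\<lambda>x. gaussian \<sigma> x * (norm (?H x))\<^sup>2)"
    using integrable_gaussian_mult_bounded[OF \<sigma>, where B = "?B\<^sup>2" and H = "\<lambda>x. (norm (?H x))\<^sup>2"]
    by (simp add: norm_fourier_synthesis_le power_mono)
  have "complex_of_real (\<integral>x. gaussian \<sigma> x * (norm (?H x))\<^sup>2 \<partial>lborel)
      = (\<integral>x. \<Phi> x * (\<integral>\<xi>. iexp (x \<bullet> \<xi>) * h \<xi> \<partial>lborel) \<partial>lborel)"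
    unfolding fourier_synthesis_def[symmetric] integral_complex_of_real[symmetric]
    by (rule Bochner_Integration.integral_cong)
       (simp_all only: \<Phi>_def scaleR_conv_of_real complex_norm_square of_real_mult mult_ac)
  also have "\<dots> = (\<integral>\<xi>. h \<xi> * (\<integral>x. iexp (x \<bullet> \<xi>) * \<Phi> x \<partial>lborel) \<partial>lborel)"
    by (intro Fubini_bounded_kernel int_\<Phi> h kernel) auto
  also have "\<dots> = (\<integral>\<xi>. h \<xi> * (\<integral>\<eta>. cnj (h \<eta>) * complex_of_real (gaussian_transform \<sigma> (\<xi> - \<eta>)) \<partial>lborel) \<partial>lborel)"
    by (simp only: inner)
  finally have eq: "complex_of_real (\<integral>x. gaussian \<sigma> x * (norm (?H x))\<^sup>2 \<partial>lborel) = \<dots>" .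

  have "(\<integral>\<^sup>+x. ennreal (gaussian \<sigma> x * (norm (?H x))\<^sup>2) \<partial>lborel)
      = ennreal (\<integral>x. gaussian \<sigma> x * (norm (?H x))\<^sup>2 \<partial>lborel)"
    by (rule nn_integral_eq_integral[OF int]) (auto simp: gaussian_def)
  also have "\<dots> = ennreal (norm (complex_of_real (\<integral>x. gaussian \<sigma> x * (norm (?H x))\<^sup>2 \<partial>lborel)))"
    by (subst norm_of_real, subst abs_of_nonneg) (auto simp: gaussian_def intro!: integral_nonneg)
  also have "\<dots> \<le> (\<integral>\<^sup>+\<xi>. \<integral>\<^sup>+\<eta>. ennreal (norm (h \<xi>) * norm (h \<eta>) * gaussian_transform \<sigma> (\<xi> - \<eta>)) \<partial>lborel \<partial>lborel)"
    unfolding eq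
  proof (rule order_trans[OF norm_integral_le_nn_integral])
    show "(\<integral>\<^sup>+\<xi>. ennreal (norm (h \<xi> * (\<integral>\<eta>. cnj (h \<eta>) * complex_of_real (gaussian_transform \<sigma> (\<xi> - \<eta>)) \<partial>lborel))) \<partial>lborel)
      \<le> (\<integral>\<^sup>+\<xi>. \<integral>\<^sup>+\<eta>. ennreal (norm (h \<xi>) * norm (h \<eta>) * gaussian_transform \<sigma> (\<xi> - \<eta>)) \<partial>lborel \<partial>lborel)"
    proof (rule nn_integral_mono)
      fix \<xi> :: 'a
      have "ennreal (norm (h \<xi> * (\<integral>\<eta>. cnj (h \<eta>) * complex_of_real (gaussian_transform \<sigma> (\<xi> - \<eta>)) \<partial>lborel)))
         \<le> ennreal (norm (h \<xi>)) * (\<integral>\<^sup>+\<eta>. norm (cnj (h \<eta>) * complex_of_real (gaussian_transform \<sigma> (\<xi> - \<eta>))) \<partial>lborel)"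
        by (subst norm_mult, subst ennreal_mult) (auto intro: mult_left_mono norm_integral_le_nn_integral)
      also have "\<dots> = (\<integral>\<^sup>+\<eta>. ennreal (norm (h \<xi>) * norm (h \<eta>) * gaussian_transform \<sigma> (\<xi> - \<eta>)) \<partial>lborel)"
        by (subst nn_integral_cmult[symmetric])
           (auto simp: norm_mult gaussian_transform_nonneg ennreal_mult mult_ac)
      finally show "ennreal (norm (h \<xi> * (\<integral>\<eta>. cnj (h \<eta>) * complex_of_real (gaussian_transform \<sigma> (\<xi> - \<eta>)) \<partial>lborel)))
        \<le> (\<integral>\<^sup>+\<eta>. ennreal (norm (h \<xi>) * norm (h \<eta>) * gaussian_transform \<sigma> (\<xi> - \<eta>)) \<partial>lborel)" .
    qed
  qed
  also have "\<dots> \<le> (\<integral>\<^sup>+u. ennreal (gaussian_transform \<sigma> (u::'a)) \<partial>lborel) * (\<integral>\<^sup>+\<xi>. ennreal ((norm (h \<xi>))\<^sup>2) \<partial>lborel)"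
    by (rule schur_test_convolution) (auto simp: gaussian_transform_nonneg)
  finally show ?thesis
    by (simp only: nn_integral_gaussian_transform[OF \<sigma>])
qed

text \<open>The weights \<open>gaussian n\<close> tend to \<open>1\<close> pointwise, so Fatou's lemma applies to the uniform weighted bounds.\<close>

lemma plancherel_inequality:
  fixes h :: "'a::euclidean_space \<Rightarrow> complex"
  assumes h: "integrable lborel h"
  shows "(\<integral>\<^sup>+x. ennreal ((norm (fourier_synthesis h x))\<^sup>2) \<partial>lborel)
    \<le> ennreal ((2 * pi) ^ DIM('a)) * (\<integral>\<^sup>+\<xi>. ennreal ((norm (h \<xi>))\<^sup>2) \<partial>lborel)"
proof -
  have [measurable]: "h \<in> borel_measurable borel" using h by auto
  let ?F = "\<lambda>n x. ennreal (gaussian (real (Suc n)) x * (norm (fourier_synthesis h x))\<^sup>2)"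
  have "liminf (\<lambda>n. ?F n x) = ennreal ((norm (fourier_synthesis h x))\<^sup>2)" for x
  proof (intro lim_imp_Liminf tendsto_ennrealI)
    have "(\<lambda>n. - ((norm x)\<^sup>2 / 2 * (inverse (real (Suc n)))\<^sup>2)) \<longlonglongrightarrow> - ((norm x)\<^sup>2 / 2 * 0\<^sup>2)"
      by (intro tendsto_intros LIMSEQ_inverse_real_of_nat)
    then have "(\<lambda>n. gaussian (real (Suc n)) x) \<longlonglongrightarrow> exp 0"
      unfolding gaussian_def by (intro tendsto_exp) (simp add: field_simps)
    from tendsto_mult_right[OF this, of "(norm (fourier_synthesis h x))\<^sup>2"]
    show "(\<lambda>n. gaussian (real (Suc n)) x * (norm (fourier_synthesis h x))\<^sup>2) \<longlonglongrightarrow> (norm (fourier_synthesis h x))\<^sup>2"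
      by simp
  qed simp
  then have "(\<integral>\<^sup>+x. ennreal ((norm (fourier_synthesis h x))\<^sup>2) \<partial>lborel) = (\<integral>\<^sup>+x. liminf (\<lambda>n. ?F n x) \<partial>lborel)"
    by simp
  also have "\<dots> \<le> liminf (\<lambda>n. \<integral>\<^sup>+x. ?F n x \<partial>lborel)"
    by (rule nn_integral_liminf) measurable
  also have "\<dots> \<le> limsup (\<lambda>n. \<integral>\<^sup>+x. ?F n x \<partial>lborel)"
    by (rule Liminf_le_Limsup) simp
  also have "\<dots> \<le> ennreal ((2 * pi) ^ DIM('a)) * (\<integral>\<^sup>+\<xi>. ennreal ((norm (h \<xi>))\<^sup>2) \<partial>lborel)"
    by (intro Limsup_bounded always_eventually allI gaussian_plancherel h) simp
  finally show ?thesis .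
qed

section \<open>Squares in the extended nonnegative reals\<close>

lemma ennsqrt_power2: "(ennsqrt a)\<^sup>2 = a"
  by (cases a) (auto simp: ennsqrt_def ennreal_power top_power_ennreal)

lemma power2_le_power2_iff_ennreal: "a\<^sup>2 \<le> b\<^sup>2 \<longleftrightarrow> a \<le> (b::ennreal)"
proof
  assume *: "a\<^sup>2 \<le> b\<^sup>2"
  show "a \<le> b"
    using * by (cases a; cases b) (auto simp: ennreal_power top_power_ennreal power2_le_iff_abs_le top_unique)
qed (auto intro: power_mono)

lemma L2norm_power2: "(L2norm M h)\<^sup>2 = (\<integral>\<^sup>+x. (h x)\<^sup>2 \<partial>M)"
  by (simp add: L2norm_def ennsqrt_power2)

text \<open>Squaring is monotone and has an inverse, so a common bound of the squares passes to the square of the supremum.\<close>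

lemma SUP_power2_le_ennreal:
  fixes a :: "'i \<Rightarrow> ennreal"
  assumes "\<And>i. i \<in> I \<Longrightarrow> (a i)\<^sup>2 \<le> R"
  shows "(SUP i\<in>I. a i)\<^sup>2 \<le> R"
proof -
  have "a i \<le> ennsqrt R" if "i \<in> I" for i
    using assms[OF that] by (subst power2_le_power2_iff_ennreal[symmetric]) (simp add: ennsqrt_power2)
  then have "(SUP i\<in>I. a i)\<^sup>2 \<le> (ennsqrt R)\<^sup>2"
    by (intro power_mono SUP_least) auto
  then show ?thesis by (simp add: ennsqrt_power2)
qed

lemma L2norm_le_L2norm:
  assumes "(\<integral>\<^sup>+x. (h x)\<^sup>2 \<partial>M) \<le> (ennreal c)\<^sup>2 * (\<integral>\<^sup>+x. (k x)\<^sup>2 \<partial>N)"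
  shows "L2norm M h \<le> ennreal c * L2norm N k"
  using assms by (subst power2_le_power2_iff_ennreal[symmetric]) (simp add: L2norm_power2 power_mult_distrib)

section \<open>A maximal inequality for unimodular multipliers\<close>

text \<open>For \<open>\<phi>(\<xi>) = \<xi>\<^sub>1 \<xi>\<^sub>2\<close> this is the Fourier side of the nonelliptic Schroedinger evolution.\<close>

definition evolve :: "('a \<Rightarrow> real) \<Rightarrow> ('a \<Rightarrow> complex) \<Rightarrow> real \<Rightarrow> 'a \<Rightarrow> complex" where
  "evolve \<phi> g t \<xi> = iexp (t * \<phi> \<xi>) * g \<xi>"

lemma norm_evolve [simp]: "norm (evolve \<phi> g t \<xi>) = norm (g \<xi>)"
  by (simp add: evolve_def norm_mult)

lemma integrable_evolve:
  fixes g :: "'a::euclidean_space \<Rightarrow> complex"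
  assumes [measurable]: "\<phi> \<in> borel_measurable borel" and g: "integrable lborel g"
  shows "integrable lborel (evolve \<phi> g t)"
proof (rule Bochner_Integration.integrable_bound[OF g])
  have [measurable]: "g \<in> borel_measurable borel" using g by auto
  show "evolve \<phi> g t \<in> borel_measurable lborel"
    unfolding evolve_def[abs_def] by measurable
qed simp

lemma integrable_phase_mult:
  fixes \<phi> :: "'a::euclidean_space \<Rightarrow> real" and g :: "'a::euclidean_space \<Rightarrow> complex"
  assumes [measurable]: "\<phi> \<in> borel_measurable borel" and g: "integrable lborel g"
    and bound: "\<And>\<xi>. g \<xi> \<noteq> 0 \<Longrightarrow> \<bar>\<phi> \<xi>\<bar> \<le> M"
  shows "integrable lborel (\<lambda>\<xi>. \<i> * \<phi> \<xi> * g \<xi>)"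
proof (rule Bochner_Integration.integrable_bound)
  have [measurable]: "g \<in> borel_measurable borel" using g by auto
  show "integrable lborel (\<lambda>\<xi>. M * norm (g \<xi>))" using g by simp
  have "norm (\<i> * \<phi> \<xi> * g \<xi>) \<le> norm (M * norm (g \<xi>))" for \<xi>
    using bound[of \<xi>] by (cases "g \<xi> = 0") (auto simp: norm_mult abs_mult intro!: mult_right_mono)
  then show "AE \<xi> in lborel. norm (\<i> * \<phi> \<xi> * g \<xi>) \<le> norm (M * norm (g \<xi>))"
    by simp
  show "(\<lambda>\<xi>. \<i> * \<phi> \<xi> * g \<xi>) \<in> borel_measurable lborel" by measurable
qed

lemma norm_iexp_quadratic: "norm (iexp x - 1 - \<i> * x) \<le> x\<^sup>2"
proof -
  have "norm (iexp x - 1 - \<i> * x) \<le> x\<^sup>2 / 2"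
    using iexp_approx1[of x 1] by (simp add: algebra_simps power2_eq_square)
  then show ?thesis
    using zero_le_power2[of x] by linarith
qed

text \<open>As \<open>\<phi>\<close> is bounded by \<open>M\<close> where \<open>g\<close> does not vanish, the second-order Taylor bound for the
  exponential is uniform in the frequency and integrates to an error of order \<open>(s - t)\<^sup>2\<close>.\<close>

lemma fourier_synthesis_evolve_has_vector_derivative:
  fixes g :: "'a::euclidean_space \<Rightarrow> complex"
  assumes [measurable]: "\<phi> \<in> borel_measurable borel" and g: "integrable lborel g"
    and bound: "\<And>\<xi>. g \<xi> \<noteq> 0 \<Longrightarrow> \<bar>\<phi> \<xi>\<bar> \<le> M"
  shows "((\<lambda>t. fourier_synthesis (evolve \<phi> g t) x) has_vector_derivative
    fourier_synthesis (evolve \<phi> (\<lambda>\<xi>. \<i> * \<phi> \<xi> * g \<xi>) t) x) (at t)"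
proof -
  let ?S = "\<lambda>t. fourier_synthesis (evolve \<phi> g t) x" and ?D = "fourier_synthesis (evolve \<phi> (\<lambda>\<xi>. \<i> * \<phi> \<xi> * g \<xi>) t) x"
  have [measurable]: "g \<in> borel_measurable borel" using g by auto
  have Dg: "integrable lborel (\<lambda>\<xi>. \<i> * \<phi> \<xi> * g \<xi>)"
    by (rule integrable_phase_mult[OF assms])
  have int: "integrable lborel (\<lambda>\<xi>. iexp (x \<bullet> \<xi>) * evolve \<phi> h s \<xi>)" if "integrable lborel h" for h s
    by (rule Bochner_Integration.integrable_bound[OF integrable_evolve[OF assms(1) that, of s]])
       (use integrable_evolve[OF assms(1) that, of s] in \<open>auto simp: norm_mult\<close>)
  let ?N = "\<integral>\<xi>. norm (g \<xi>) \<partial>lborel"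
  have quad: "norm (?S s - ?S t - (s - t) *\<^sub>R ?D) \<le> M\<^sup>2 * ?N * (s - t)\<^sup>2" for s
  proof -
    have "?S s - ?S t - (s - t) *\<^sub>R ?D = (\<integral>\<xi>. iexp (x \<bullet> \<xi>) * evolve \<phi> g s \<xi> - iexp (x \<bullet> \<xi>) * evolve \<phi> g t \<xi>
        - (s - t) *\<^sub>R (iexp (x \<bullet> \<xi>) * evolve \<phi> (\<lambda>\<xi>. \<i> * \<phi> \<xi> * g \<xi>) t \<xi>) \<partial>lborel)"
      unfolding fourier_synthesis_def using int[OF g] int[OF Dg] by simp
    also have "\<dots> = (\<integral>\<xi>. iexp (x \<bullet> \<xi>) * (iexp (t * \<phi> \<xi>) * (iexp ((s - t) * \<phi> \<xi>) - 1 - \<i> * ((s - t) * \<phi> \<xi>)) * g \<xi>) \<partial>lborel)"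
    proof (rule Bochner_Integration.integral_cong[OF refl])
      fix \<xi>
      have "iexp (s * \<phi> \<xi>) = iexp (t * \<phi> \<xi>) * iexp ((s - t) * \<phi> \<xi>)"
        unfolding exp_add[symmetric] by (simp add: algebra_simps)
      moreover have "X * (T * R * G) - X * (T * G) - d * (X * (T * (\<i> * p * G))) = X * (T * (R - 1 - \<i> * (d * p)) * G)"
        for X T R G d p :: complex
        by (simp add: algebra_simps)
      ultimately show "iexp (x \<bullet> \<xi>) * evolve \<phi> g s \<xi> - iexp (x \<bullet> \<xi>) * evolve \<phi> g t \<xi>
        - (s - t) *\<^sub>R (iexp (x \<bullet> \<xi>) * evolve \<phi> (\<lambda>\<xi>. \<i> * \<phi> \<xi> * g \<xi>) t \<xi>)
        = iexp (x \<bullet> \<xi>) * (iexp (t * \<phi> \<xi>) * (iexp ((s - t) * \<phi> \<xi>) - 1 - \<i> * ((s - t) * \<phi> \<xi>)) * g \<xi>)"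
        unfolding evolve_def scaleR_conv_of_real of_real_mult by (simp only:)
    qed
    also have "norm \<dots> \<le> (\<integral>\<xi>. M\<^sup>2 * (s - t)\<^sup>2 * norm (g \<xi>) \<partial>lborel)"
    proof (rule Bochner_Integration.integral_norm_bound_integral)
      have *: "norm (iexp (x \<bullet> \<xi>) * (iexp (t * \<phi> \<xi>) * (iexp ((s - t) * \<phi> \<xi>) - 1 - \<i> * ((s - t) * \<phi> \<xi>)) * g \<xi>))
          \<le> M\<^sup>2 * (s - t)\<^sup>2 * norm (g \<xi>)" for \<xi>
      proof (cases "g \<xi> = 0")
        case False
        then have "\<bar>\<phi> \<xi>\<bar>\<^sup>2 \<le> M\<^sup>2"
          using bound by (intro power_mono) auto
        then have "(s - t)\<^sup>2 * (\<phi> \<xi>)\<^sup>2 \<le> (s - t)\<^sup>2 * M\<^sup>2"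
          by (intro mult_left_mono) auto
        moreover have "norm (iexp ((s - t) * \<phi> \<xi>) - 1 - \<i> * ((s - t) * \<phi> \<xi>)) \<le> (s - t)\<^sup>2 * (\<phi> \<xi>)\<^sup>2"
          using norm_iexp_quadratic[of "(s - t) * \<phi> \<xi>"] by (simp add: power_mult_distrib)
        ultimately have "norm (iexp ((s - t) * \<phi> \<xi>) - 1 - \<i> * ((s - t) * \<phi> \<xi>)) * norm (g \<xi>) \<le> M\<^sup>2 * (s - t)\<^sup>2 * norm (g \<xi>)"
          by (intro mult_right_mono) (auto simp: mult.commute)
        then show ?thesis
          by (simp only: norm_mult norm_exp_i_times mult_1)
      qed simp
      show "integrable lborel (\<lambda>\<xi>. M\<^sup>2 * (s - t)\<^sup>2 * norm (g \<xi>))" using g by simp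
      then show "integrable lborel (\<lambda>\<xi>. iexp (x \<bullet> \<xi>) * (iexp (t * \<phi> \<xi>) * (iexp ((s - t) * \<phi> \<xi>) - 1 - \<i> * ((s - t) * \<phi> \<xi>)) * g \<xi>))"
        by (rule Bochner_Integration.integrable_bound) (use * in \<open>auto intro: order_trans[OF _ abs_ge_self]\<close>)
      show "norm (iexp (x \<bullet> \<xi>) * (iexp (t * \<phi> \<xi>) * (iexp ((s - t) * \<phi> \<xi>) - 1 - \<i> * ((s - t) * \<phi> \<xi>)) * g \<xi>))
          \<le> M\<^sup>2 * (s - t)\<^sup>2 * norm (g \<xi>)" for \<xi> by (rule *)
    qed
    finally show ?thesis by (simp add: mult_ac)
  qed
  show ?thesis
    unfolding has_vector_derivative_def has_derivative_at_alt
  proof (intro conjI allI impI)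
    fix e :: real assume e: "0 < e"
    define K where "K = M\<^sup>2 * ?N + 1"
    have K: "0 < K" unfolding K_def by (intro add_nonneg_pos mult_nonneg_nonneg) auto
    show "\<exists>d>0. \<forall>s. norm (s - t) < d \<longrightarrow> norm (?S s - ?S t - (s - t) *\<^sub>R ?D) \<le> e * norm (s - t)"
    proof (intro exI[of _ "e / K"] conjI allI impI)
      show "0 < e / K" using e K by simp
      fix s assume s: "norm (s - t) < e / K"
      have "norm (?S s - ?S t - (s - t) *\<^sub>R ?D) \<le> M\<^sup>2 * ?N * (s - t)\<^sup>2" by (rule quad)
      also have "\<dots> \<le> K * (s - t)\<^sup>2" by (intro mult_right_mono) (auto simp: K_def)
      also have "\<dots> = K * norm (s - t) * norm (s - t)" by (simp add: power2_eq_square)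
      also have "\<dots> \<le> e * norm (s - t)"
        using s K by (intro mult_right_mono) (auto simp: field_simps)
      finally show "norm (?S s - ?S t - (s - t) *\<^sub>R ?D) \<le> e * norm (s - t)" .
    qed
  qed (rule bounded_linear_scaleR_left)
qed

lemma fourier_synthesis_evolve_measurable [measurable]:
  fixes g :: "'a::euclidean_space \<Rightarrow> complex"
  assumes [measurable]: "\<phi> \<in> borel_measurable borel" "g \<in> borel_measurable borel"
  shows "(\<lambda>(t, x). fourier_synthesis (evolve \<phi> g t) x) \<in> borel_measurable (lborel \<Otimes>\<^sub>M lborel)"
  unfolding fourier_synthesis_def evolve_def by measurable

lemma plancherel_evolve:
  fixes g :: "'a::euclidean_space \<Rightarrow> complex"
  assumes "\<phi> \<in> borel_measurable borel" "integrable lborel g"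
  shows "(\<integral>\<^sup>+x. ennreal ((norm (fourier_synthesis (evolve \<phi> g t) x))\<^sup>2) \<partial>lborel)
    \<le> ennreal ((2 * pi) ^ DIM('a)) * (\<integral>\<^sup>+\<xi>. ennreal ((norm (g \<xi>))\<^sup>2) \<partial>lborel)"
  using plancherel_inequality[OF integrable_evolve[OF assms]] by simp

text \<open>The one-dimensional Sobolev embedding, with the weight \<open>M\<close> chosen to
  balance \<open>u\<close> against a derivative that is \<open>M\<close> times larger. The bound is the same for all \<open>t\<close>.\<close>

lemma sobolev_in_time:
  fixes u v :: "real \<Rightarrow> 'a::{real_inner, banach, second_countable_topology}"
  assumes u: "\<And>t. (u has_vector_derivative v t) (at t)" and v: "continuous_on UNIV v"
    and I: "is_interval I" "s \<in> I" "t \<in> I" and M: "0 < M"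
  shows "ennreal ((norm (u t))\<^sup>2) \<le> ennreal ((norm (u s))\<^sup>2)
    + (\<integral>\<^sup>+r. indicator I r * ennreal (M * (norm (u r))\<^sup>2 + (norm (v r))\<^sup>2 / M) \<partial>lborel)"
proof -
  let ?R = "\<integral>\<^sup>+r. indicator I r * ennreal (M * (norm (u r))\<^sup>2 + (norm (v r))\<^sup>2 / M) \<partial>lborel"
  let ?d = "\<lambda>r. 2 * (u r \<bullet> v r)"
  have cu: "continuous_on UNIV u"
    by (intro continuous_at_imp_continuous_on ballI has_vector_derivative_continuous[OF u])
  have der: "((\<lambda>r. (norm (u r))\<^sup>2) has_vector_derivative ?d r) (at r within A)" for r A
    by (rule has_vector_derivative_at_within)
       (use bounded_bilinear.has_vector_derivative[OF bounded_bilinear_inner u u, of r] in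
         \<open>simp add: power2_norm_eq_inner inner_commute\<close>)
  have bound: "\<bar>?d r\<bar> \<le> M * (norm (u r))\<^sup>2 + (norm (v r))\<^sup>2 / M" for r
  proof -
    have "\<bar>u r \<bullet> v r\<bar> \<le> norm (u r) * norm (v r)" by (rule Cauchy_Schwarz_ineq2)
    moreover have "0 \<le> (M * norm (u r) - norm (v r))\<^sup>2 / M"
      using M by simp
    then have "2 * (norm (u r) * norm (v r)) \<le> M * (norm (u r))\<^sup>2 + (norm (v r))\<^sup>2 / M"
      using M by (simp add: power2_diff field_simps power2_eq_square)
    ultimately show ?thesis by (simp add: abs_mult)
  qed
  have incr: "ennreal \<bar>(norm (u b))\<^sup>2 - (norm (u a))\<^sup>2\<bar> \<le> ?R" if "a \<le> b" "a \<in> I" "b \<in> I" for a b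
  proof -
    have sub: "{a..b} \<subseteq> I"
      using mem_is_interval_1_I[OF I(1) that(2,3)] by auto
    have "(\<integral>r. indicat_real {a..b} r *\<^sub>R ?d r \<partial>lborel) = (norm (u b))\<^sup>2 - (norm (u a))\<^sup>2"
      by (intro integral_FTC_atLeastAtMost that(1) der continuous_intros continuous_on_subset[OF cu] continuous_on_subset[OF v]) auto
    then have "ennreal \<bar>(norm (u b))\<^sup>2 - (norm (u a))\<^sup>2\<bar> \<le> (\<integral>\<^sup>+r. ennreal (norm (indicat_real {a..b} r *\<^sub>R ?d r)) \<partial>lborel)"
      using norm_integral_le_nn_integral[of lborel "\<lambda>r. indicat_real {a..b} r *\<^sub>R ?d r"] by simp
    also have "\<dots> \<le> ?R"
      using sub bound by (intro nn_integral_mono) (auto simp: indicator_def intro: ennreal_leI)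
    finally show ?thesis .
  qed
  have "ennreal \<bar>(norm (u t))\<^sup>2 - (norm (u s))\<^sup>2\<bar> \<le> ?R"
    using incr[of s t] incr[of t s] I by (cases "s \<le> t") (auto simp: abs_minus_commute)
  moreover have "ennreal ((norm (u t))\<^sup>2) \<le> ennreal ((norm (u s))\<^sup>2) + ennreal \<bar>(norm (u t))\<^sup>2 - (norm (u s))\<^sup>2\<bar>"
    by (subst ennreal_plus[symmetric], simp, simp, intro ennreal_leI) linarith
  ultimately show ?thesis
    by (meson add_left_mono order_trans)
qed

text \<open>The Sobolev bound is integrated over \<open>x\<close>. The multiplier \<open>\<i> \<phi>\<close> that produces the time
  derivative costs a factor of at most \<open>M\<close>, so with the weight \<open>M\<close> the two terms under the
  time integral obey the same bound.\<close>

lemma maximal_inequality: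
  fixes g :: "'a::euclidean_space \<Rightarrow> complex"
  assumes \<phi>: "\<phi> \<in> borel_measurable borel" and g: "integrable lborel g"
    and bound: "\<And>\<xi>. g \<xi> \<noteq> 0 \<Longrightarrow> \<bar>\<phi> \<xi>\<bar> \<le> M" and M: "0 < M"
    and I: "is_interval I" "I \<noteq> {}"
  shows "(\<integral>\<^sup>+x. (SUP t\<in>I. ennreal (norm (fourier_synthesis (evolve \<phi> g t) x)))\<^sup>2 \<partial>lborel)
    \<le> (1 + 2 * ennreal M * emeasure lborel I) * (ennreal ((2 * pi) ^ DIM('a)) * (\<integral>\<^sup>+\<xi>. ennreal ((norm (g \<xi>))\<^sup>2) \<partial>lborel))"
proof -
  obtain s where s: "s \<in> I" using I(2) by blast
  define g' where "g' = (\<lambda>\<xi>. \<i> * \<phi> \<xi> * g \<xi>)"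
  let ?S = "\<lambda>t. fourier_synthesis (evolve \<phi> g t)" and ?D = "\<lambda>t. fourier_synthesis (evolve \<phi> g' t)"
  let ?P = "ennreal ((2 * pi) ^ DIM('a)) * (\<integral>\<^sup>+\<xi>. ennreal ((norm (g \<xi>))\<^sup>2) \<partial>lborel)"
  let ?b = "\<lambda>r x. ennreal (M * (norm (?S r x))\<^sup>2 + (norm (?D r x))\<^sup>2 / M)"
  note \<phi>[measurable]
  have g': "integrable lborel g'"
    unfolding g'_def by (rule integrable_phase_mult[OF \<phi> g bound])
  have [measurable]: "g \<in> borel_measurable borel" "g' \<in> borel_measurable borel" using g g' by auto
  have I_borel [measurable]: "I \<in> sets borel" using real_interval_borel_measurable[OF I(1)] .
  have g'_bound: "\<bar>\<phi> \<xi>\<bar> \<le> M" if "g' \<xi> \<noteq> 0" for \<xi>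
    using that bound by (auto simp: g'_def)
  have derS: "((\<lambda>t. ?S t x) has_vector_derivative ?D t x) (at t)" for t x
    unfolding g'_def by (rule fourier_synthesis_evolve_has_vector_derivative[OF \<phi> g bound])
  have contD: "continuous_on UNIV (\<lambda>t. ?D t x)" for x
    by (intro continuous_at_imp_continuous_on ballI)
       (rule has_vector_derivative_continuous[OF fourier_synthesis_evolve_has_vector_derivative[OF \<phi> g' g'_bound]])
  have D_le: "(\<integral>\<^sup>+x. ennreal ((norm (?D r x))\<^sup>2) \<partial>lborel) \<le> ennreal (M\<^sup>2) * ?P" for r
  proof -
    have "(norm (g' \<xi>))\<^sup>2 \<le> M\<^sup>2 * (norm (g \<xi>))\<^sup>2" for \<xi>
    proof (cases "g \<xi> = 0")
      case False
      then have "\<bar>\<phi> \<xi>\<bar>\<^sup>2 \<le> M\<^sup>2" by (intro power_mono bound) auto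
      then show ?thesis by (auto simp: g'_def norm_mult power_mult_distrib intro: mult_right_mono)
    qed (simp add: g'_def)
    then have "(\<integral>\<^sup>+\<xi>. ennreal ((norm (g' \<xi>))\<^sup>2) \<partial>lborel) \<le> (\<integral>\<^sup>+\<xi>. ennreal (M\<^sup>2) * ennreal ((norm (g \<xi>))\<^sup>2) \<partial>lborel)"
      by (intro nn_integral_mono) (auto simp: ennreal_mult[symmetric] intro!: ennreal_leI)
    also have "\<dots> = ennreal (M\<^sup>2) * (\<integral>\<^sup>+\<xi>. ennreal ((norm (g \<xi>))\<^sup>2) \<partial>lborel)"
      by (rule nn_integral_cmult) measurable
    finally have "ennreal ((2 * pi) ^ DIM('a)) * (\<integral>\<^sup>+\<xi>. ennreal ((norm (g' \<xi>))\<^sup>2) \<partial>lborel) \<le> ennreal (M\<^sup>2) * ?P"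
      by (subst mult.left_commute) (rule mult_left_mono, auto)
    then show ?thesis
      using plancherel_evolve[OF \<phi> g'] order_trans by blast
  qed
  have b_le: "(\<integral>\<^sup>+x. ?b r x \<partial>lborel) \<le> 2 * ennreal M * ?P" for r
  proof -
    have "(\<integral>\<^sup>+x. ?b r x \<partial>lborel)
        = (\<integral>\<^sup>+x. ennreal M * ennreal ((norm (?S r x))\<^sup>2) + ennreal (1 / M) * ennreal ((norm (?D r x))\<^sup>2) \<partial>lborel)"
      using M by (simp add: ennreal_mult[symmetric])
    also have "\<dots> = ennreal M * (\<integral>\<^sup>+x. ennreal ((norm (?S r x))\<^sup>2) \<partial>lborel)
        + ennreal (1 / M) * (\<integral>\<^sup>+x. ennreal ((norm (?D r x))\<^sup>2) \<partial>lborel)"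
      using integrable_evolve[OF \<phi> g] integrable_evolve[OF \<phi> g'] by (simp add: nn_integral_add nn_integral_cmult)
    also have "\<dots> \<le> ennreal M * ?P + ennreal (1 / M) * (ennreal (M\<^sup>2) * ?P)"
      by (intro add_mono mult_left_mono plancherel_evolve \<phi> g D_le) auto
    also have "ennreal (1 / M) * (ennreal (M\<^sup>2) * ?P) = ennreal M * ?P"
      using M by (simp add: mult.assoc[symmetric] ennreal_mult[symmetric] power2_eq_square)
    finally show ?thesis by (simp only: mult.assoc mult_2[of "ennreal M * ?P"])
  qed
  have [measurable]: "(\<lambda>x. ?b r x) \<in> borel_measurable borel" "?S r \<in> borel_measurable borel" for r
    using integrable_evolve[OF \<phi> g] integrable_evolve[OF \<phi> g'] by measurable
  have joint [measurable]: "(\<lambda>(r, x). indicator I r * ?b r x) \<in> borel_measurable (lborel \<Otimes>\<^sub>M lborel)"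
    using fourier_synthesis_evolve_measurable[of \<phi> g] fourier_synthesis_evolve_measurable[of \<phi> g'] by measurable
  have "(\<integral>\<^sup>+x. \<integral>\<^sup>+r. indicator I r * ?b r x \<partial>lborel \<partial>lborel) = (\<integral>\<^sup>+r. \<integral>\<^sup>+x. indicator I r * ?b r x \<partial>lborel \<partial>lborel)"
    by (rule lborel_pair.Fubini') measurable
  also have "\<dots> = (\<integral>\<^sup>+r. (\<integral>\<^sup>+x. ?b r x \<partial>lborel) * indicator I r \<partial>lborel)"
    by (subst mult.commute, intro nn_integral_cong nn_integral_multc) measurable
  also have "\<dots> \<le> (\<integral>\<^sup>+r. (2 * ennreal M * ?P) * indicator I r \<partial>lborel)"
    by (intro nn_integral_mono mult_right_mono b_le) simp
  also have "\<dots> = (2 * ennreal M * ?P) * emeasure lborel I"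
    by (rule nn_integral_cmult_indicator) simp
  finally have time: "(\<integral>\<^sup>+x. \<integral>\<^sup>+r. indicator I r * ?b r x \<partial>lborel \<partial>lborel) \<le> (2 * ennreal M * ?P) * emeasure lborel I" .
  have "(\<integral>\<^sup>+x. (SUP t\<in>I. ennreal (norm (?S t x)))\<^sup>2 \<partial>lborel)
      \<le> (\<integral>\<^sup>+x. ennreal ((norm (?S s x))\<^sup>2) + (\<integral>\<^sup>+r. indicator I r * ?b r x \<partial>lborel) \<partial>lborel)"
    by (intro nn_integral_mono SUP_power2_le_ennreal)
       (auto simp: ennreal_power intro!: sobolev_in_time[OF derS contD I(1) s _ M])
  also have "\<dots> = (\<integral>\<^sup>+x. ennreal ((norm (?S s x))\<^sup>2) \<partial>lborel) + (\<integral>\<^sup>+x. \<integral>\<^sup>+r. indicator I r * ?b r x \<partial>lborel \<partial>lborel)"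
    by (rule nn_integral_add) measurable
  also have "\<dots> \<le> ?P + (2 * ennreal M * ?P) * emeasure lborel I"
    by (intro add_mono plancherel_evolve[OF \<phi> g] time)
  also have "\<dots> = (1 + 2 * ennreal M * emeasure lborel I) * ?P"
    by (subst distrib_right) (simp only: mult_1 mult_ac)
  finally show ?thesis .
qed

section \<open>The transform of a square-integrable function\<close>

text \<open>Fubini's theorem is used for Borel functions, whereas elements of \<^const>\<open>L2\<close> are only Lebesgue
  measurable; this provides the Borel representatives.\<close>

lemma lebesgue_measurable_ex_borel_complex:
  fixes g :: "'a::euclidean_space \<Rightarrow> complex"
  assumes [measurable]: "g \<in> borel_measurable lebesgue"
  obtains g' where "g' \<in> borel_measurable borel" "AE x in lborel. g x = g' x"
proof -
  obtain r where r [measurable]: "r \<in> borel_measurable lborel" "AE x in lborel. Re (g x) = r x"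
    using completion_ex_borel_measurable_real[of "\<lambda>x. Re (g x)" lborel] by auto
  obtain i where i [measurable]: "i \<in> borel_measurable lborel" "AE x in lborel. Im (g x) = i x"
    using completion_ex_borel_measurable_real[of "\<lambda>x. Im (g x)" lborel] by auto
  show thesis
  proof
    show "(\<lambda>x. complex_of_real (r x) + \<i> * complex_of_real (i x)) \<in> borel_measurable borel"
      using r(1) i(1) by simp
    show "AE x in lborel. g x = complex_of_real (r x) + \<i> * complex_of_real (i x)"
      using r(2) i(2) by eventually_elim (simp add: complex_eq_iff)
  qed
qed

lemma L2_iff: "f \<in> L2 \<longleftrightarrow> f \<in> borel_measurable lebesgue \<and> (\<integral>\<^sup>+x. ennreal ((norm (f x))\<^sup>2) \<partial>lborel) < \<infinity>"
proof -
  have "L2norm lebesgue (\<lambda>x. ennreal (norm (f x))) < \<infinity> \<longleftrightarrow> (\<integral>\<^sup>+x. ennreal ((norm (f x))\<^sup>2) \<partial>lborel) < \<infinity>"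
    by (simp add: L2norm_def ennsqrt_def nn_integral_completion ennreal_power top.not_eq_extremum)
  then show ?thesis by (auto simp: L2_def)
qed

text \<open>Pointwise \<open>\<bar>g\<bar> \<le> 1 + \<bar>g\<bar>\<^sup>2\<close>, and the constant is integrable over a ball.\<close>

lemma integrable_bounded_support:
  fixes g :: "'a::euclidean_space \<Rightarrow> complex"
  assumes [measurable]: "g \<in> borel_measurable borel"
    and fin: "(\<integral>\<^sup>+x. ennreal ((norm (g x))\<^sup>2) \<partial>lborel) < \<infinity>" and supp: "\<And>x. x \<notin> cball 0 R \<Longrightarrow> g x = 0"
  shows "integrable lborel g"
proof (rule integrableI_bounded)
  have "norm (g x) \<le> 1 + (norm (g x))\<^sup>2" for x
  proof -
    have "2 * norm (g x) \<le> 1 + (norm (g x))\<^sup>2"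
      using zero_le_power2[of "norm (g x) - 1"] by (simp add: power2_diff)
    then show ?thesis
      using norm_ge_zero[of "g x"] by linarith
  qed
  then have "(\<integral>\<^sup>+x. ennreal (norm (g x)) \<partial>lborel) \<le> (\<integral>\<^sup>+x. indicator (cball 0 R) x + ennreal ((norm (g x))\<^sup>2) \<partial>lborel)"
    using supp by (intro nn_integral_mono)
      (auto simp: indicator_def ennreal_plus[symmetric] ennreal_1[symmetric] simp del: ennreal_plus ennreal_1 intro!: ennreal_leI)
  also have "\<dots> = emeasure lborel (cball (0::'a) R) + (\<integral>\<^sup>+x. ennreal ((norm (g x))\<^sup>2) \<partial>lborel)"
    by (subst nn_integral_add) (auto intro!: borel_measurable_indicator)
  also have "\<dots> < \<infinity>"
    using fin emeasure_lborel_cball_finite[of "0::'a" R] by (simp add: ennreal_add_less_top less_top)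
  finally show "(\<integral>\<^sup>+x. ennreal (norm (g x)) \<partial>lborel) < \<infinity>" .
qed simp

text \<open>A truncation is integrable, so its Fourier integral is, up to a reflection and the factor
  \<open>(2\<pi>)\<^bsup>-2\<^esup>\<close>, covered by \<open>plancherel_inequality\<close>.\<close>

lemma fourier_integral_measurable_and_bound:
  assumes f: "f \<in> L2"
  shows "fourier_integral (\<lambda>x. indicator (cball 0 R) x * f x) \<in> borel_measurable borel" (is "?F \<in> _")
    and "(\<integral>\<^sup>+\<xi>. ennreal ((norm (fourier_integral (\<lambda>x. indicator (cball 0 R) x * f x) \<xi>))\<^sup>2) \<partial>lborel)
      \<le> ennreal (1 / (2 * pi)\<^sup>2) * (\<integral>\<^sup>+x. ennreal ((norm (f x))\<^sup>2) \<partial>lborel)"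
proof -
  have f_meas [measurable]: "f \<in> borel_measurable lebesgue" and fin: "(\<integral>\<^sup>+x. ennreal ((norm (f x))\<^sup>2) \<partial>lborel) < \<infinity>"
    using f by (auto simp: L2_iff)
  obtain f' where f' [measurable]: "f' \<in> borel_measurable borel" and ae: "AE x in lborel. f x = f' x"
    using lebesgue_measurable_ex_borel_complex[OF f_meas] .
  have [measurable]: "cball (0 :: real^2) R \<in> sets borel" by simp
  define h where "h = (\<lambda>x. indicator (cball 0 R) x * f' x)"
  have [measurable]: "h \<in> borel_measurable borel" unfolding h_def by measurable
  have "(\<integral>\<^sup>+x. ennreal ((norm (h x))\<^sup>2) \<partial>lborel) \<le> (\<integral>\<^sup>+x. ennreal ((norm (f' x))\<^sup>2) \<partial>lborel)"
    by (intro nn_integral_mono ennreal_leI) (auto simp: h_def indicator_def)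
  also have "\<dots> = (\<integral>\<^sup>+x. ennreal ((norm (f x))\<^sup>2) \<partial>lborel)"
    using ae by (intro nn_integral_cong_AE) auto
  finally have h_le: "(\<integral>\<^sup>+x. ennreal ((norm (h x))\<^sup>2) \<partial>lborel) \<le> (\<integral>\<^sup>+x. ennreal ((norm (f x))\<^sup>2) \<partial>lborel)" .
  have h_int: "integrable lborel h"
    by (rule integrable_bounded_support[OF _ le_less_trans[OF h_le fin], of R]) (auto simp: h_def)
  have eq: "?F \<xi> = complex_of_real (1 / (2 * pi)\<^sup>2) * fourier_synthesis h (0 - \<xi>)" for \<xi>
  proof -
    have [measurable]: "(\<lambda>x. exp (- (\<i> * (x \<bullet> \<xi>)))) \<in> borel_measurable lebesgue"
        "(\<lambda>x::real^2. indicator (cball 0 R) x :: complex) \<in> borel_measurable lebesgue"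
        "h \<in> borel_measurable lebesgue"
      by (intro measurable_completion; measurable)+
    have "(\<integral>x. exp (- (\<i> * (x \<bullet> \<xi>))) * (indicator (cball 0 R) x * f x) \<partial>lebesgue)
        = (\<integral>x. exp (- (\<i> * (x \<bullet> \<xi>))) * h x \<partial>lebesgue)"
    proof (rule integral_cong_AE)
      show "AE x in lebesgue. exp (- (\<i> * (x \<bullet> \<xi>))) * (indicator (cball 0 R) x * f x) = exp (- (\<i> * (x \<bullet> \<xi>))) * h x"
        using AE_completion[OF ae] by eventually_elim (simp add: h_def)
    qed measurable
    also have "\<dots> = (\<integral>x. exp (- (\<i> * (x \<bullet> \<xi>))) * h x \<partial>lborel)"
      by (rule integral_completion) measurable
    also have "\<dots> = fourier_synthesis h (0 - \<xi>)"
      unfolding fourier_synthesis_def by (rule Bochner_Integration.integral_cong) (auto simp: inner_commute)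
    finally show ?thesis by (simp add: fourier_integral_def)
  qed
  show "?F \<in> borel_measurable borel"
    unfolding eq[abs_def] by measurable
  have "(\<integral>\<^sup>+\<xi>. ennreal ((norm (?F \<xi>))\<^sup>2) \<partial>lborel)
      = (\<integral>\<^sup>+\<xi>. ennreal ((1 / (2 * pi)\<^sup>2)\<^sup>2) * ennreal ((norm (fourier_synthesis h (0 - \<xi>)))\<^sup>2) \<partial>lborel)"
    unfolding eq norm_mult norm_of_real power_mult_distrib power2_abs by (simp add: ennreal_mult)
  also have "\<dots> = ennreal ((1 / (2 * pi)\<^sup>2)\<^sup>2) * (\<integral>\<^sup>+\<xi>. ennreal ((norm (fourier_synthesis h (0 - \<xi>)))\<^sup>2) \<partial>lborel)"
    by (rule nn_integral_cmult) measurable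
  also have "(\<integral>\<^sup>+\<xi>. ennreal ((norm (fourier_synthesis h (0 - \<xi>)))\<^sup>2) \<partial>lborel) = (\<integral>\<^sup>+\<xi>. ennreal ((norm (fourier_synthesis h \<xi>))\<^sup>2) \<partial>lborel)"
    by (rule nn_integral_lborel_reflect) measurable
  also have "ennreal ((1 / (2 * pi)\<^sup>2)\<^sup>2) * \<dots>
      \<le> ennreal ((1 / (2 * pi)\<^sup>2)\<^sup>2) * (ennreal ((2 * pi) ^ DIM(real^2)) * (\<integral>\<^sup>+x. ennreal ((norm (f x))\<^sup>2) \<partial>lborel))"
    by (intro mult_left_mono order_trans[OF plancherel_inequality[OF h_int]] h_le) auto
  also have "\<dots> = ennreal ((1 / (2 * pi)\<^sup>2)\<^sup>2 * (2 * pi)\<^sup>2) * (\<integral>\<^sup>+x. ennreal ((norm (f x))\<^sup>2) \<partial>lborel)"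
    by (subst ennreal_mult) (auto simp: mult.assoc)
  also have "(1 / (2 * pi)\<^sup>2)\<^sup>2 * (2 * pi)\<^sup>2 = 1 / (2 * pi)\<^sup>2"
    by (simp add: power2_eq_square)
  finally show "(\<integral>\<^sup>+\<xi>. ennreal ((norm (?F \<xi>))\<^sup>2) \<partial>lborel)
      \<le> ennreal (1 / (2 * pi)\<^sup>2) * (\<integral>\<^sup>+x. ennreal ((norm (f x))\<^sup>2) \<partial>lborel)" .
qed

text \<open>Truncations to large balls have transforms close to \<open>g\<close> in the mean, and these obey the bound.
  The factor \<open>2\<close> comes from \<open>(a + b)\<^sup>2 \<le> 2 a\<^sup>2 + 2 b\<^sup>2\<close>, applied pointwise.\<close>

lemma L2_fourier_bound:
  assumes f: "f \<in> L2" and g: "is_L2_fourier f g"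
  shows "(\<integral>\<^sup>+\<xi>. ennreal ((norm (g \<xi>))\<^sup>2) \<partial>lborel)
    \<le> ennreal (2 / (2 * pi)\<^sup>2) * (\<integral>\<^sup>+x. ennreal ((norm (f x))\<^sup>2) \<partial>lborel)"
proof (rule ennreal_le_epsilon)
  fix e :: real assume e: "0 < e"
  let ?F = "\<lambda>R. fourier_integral (\<lambda>x. indicator (cball 0 R) x * f x)"
  have [measurable]: "g \<in> borel_measurable lebesgue" using g by (simp add: is_L2_fourier_def L2_def)
  have "((\<lambda>R. L2norm lebesgue (\<lambda>\<xi>. ennreal (norm (g \<xi> - ?F R \<xi>)))) \<longlongrightarrow> 0) at_top"
    using g by (simp add: is_L2_fourier_def)
  then have "eventually (\<lambda>R. L2norm lebesgue (\<lambda>\<xi>. ennreal (norm (g \<xi> - ?F R \<xi>))) < ennreal (sqrt (e / 2))) at_top"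
    by (rule order_tendstoD) (use e in simp)
  from eventually_happens'[OF trivial_limit_at_top_linorder this]
  obtain R where "L2norm lebesgue (\<lambda>\<xi>. ennreal (norm (g \<xi> - ?F R \<xi>))) < ennreal (sqrt (e / 2))" ..
  then have "(L2norm lebesgue (\<lambda>\<xi>. ennreal (norm (g \<xi> - ?F R \<xi>))))\<^sup>2 \<le> (ennreal (sqrt (e / 2)))\<^sup>2"
    by (intro power_mono) auto
  then have close: "(\<integral>\<^sup>+\<xi>. ennreal ((norm (g \<xi> - ?F R \<xi>))\<^sup>2) \<partial>lebesgue) \<le> ennreal (e / 2)"
    using e by (simp add: L2norm_power2 ennreal_power)
  have F_meas [measurable]: "?F R \<in> borel_measurable lebesgue"
    using fourier_integral_measurable_and_bound(1)[OF f] by (intro measurable_completion) simp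
  have "(norm (g \<xi>))\<^sup>2 \<le> 2 * (norm (g \<xi> - ?F R \<xi>))\<^sup>2 + 2 * (norm (?F R \<xi>))\<^sup>2" for \<xi>
  proof -
    have "norm (g \<xi>) \<le> norm (g \<xi> - ?F R \<xi>) + norm (?F R \<xi>)"
      using norm_triangle_ineq[of "g \<xi> - ?F R \<xi>" "?F R \<xi>"] by simp
    then have "(norm (g \<xi>))\<^sup>2 \<le> (norm (g \<xi> - ?F R \<xi>) + norm (?F R \<xi>))\<^sup>2"
      by (intro power_mono) auto
    then show ?thesis
      using zero_le_power2[of "norm (g \<xi> - ?F R \<xi>) - norm (?F R \<xi>)"] by (simp add: power2_sum power2_diff)
  qed
  then have "(\<integral>\<^sup>+\<xi>. ennreal ((norm (g \<xi>))\<^sup>2) \<partial>lebesgue)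
      \<le> (\<integral>\<^sup>+\<xi>. 2 * ennreal ((norm (g \<xi> - ?F R \<xi>))\<^sup>2) + 2 * ennreal ((norm (?F R \<xi>))\<^sup>2) \<partial>lebesgue)"
    by (intro nn_integral_mono) (simp add: ennreal_mult[symmetric] ennreal_plus[symmetric] ennreal_numeral[symmetric] del: ennreal_plus ennreal_numeral)
  also have "\<dots> = 2 * (\<integral>\<^sup>+\<xi>. ennreal ((norm (g \<xi> - ?F R \<xi>))\<^sup>2) \<partial>lebesgue) + 2 * (\<integral>\<^sup>+\<xi>. ennreal ((norm (?F R \<xi>))\<^sup>2) \<partial>lebesgue)"
    by (simp add: nn_integral_add nn_integral_cmult)
  also have "\<dots> \<le> 2 * ennreal (e / 2) + 2 * (ennreal (1 / (2 * pi)\<^sup>2) * (\<integral>\<^sup>+x. ennreal ((norm (f x))\<^sup>2) \<partial>lborel))"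
    by (intro add_mono mult_left_mono close) (auto simp only: nn_integral_completion zero_le intro!: fourier_integral_measurable_and_bound(2)[OF f])
  also have "2 * ennreal (e / 2) = ennreal e"
    using e by (simp add: ennreal_mult[symmetric] ennreal_numeral[symmetric] del: ennreal_numeral)
  also have "2 * (ennreal (1 / (2 * pi)\<^sup>2) * (\<integral>\<^sup>+x. ennreal ((norm (f x))\<^sup>2) \<partial>lborel))
      = ennreal (2 / (2 * pi)\<^sup>2) * (\<integral>\<^sup>+x. ennreal ((norm (f x))\<^sup>2) \<partial>lborel)"
    unfolding mult.assoc[symmetric] ennreal_numeral[symmetric]
    by (subst ennreal_mult[symmetric]) auto
  finally show "(\<integral>\<^sup>+\<xi>. ennreal ((norm (g \<xi>))\<^sup>2) \<partial>lborel)
    \<le> ennreal (2 / (2 * pi)\<^sup>2) * (\<integral>\<^sup>+x. ennreal ((norm (f x))\<^sup>2) \<partial>lborel) + ennreal e"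
    by (simp only: nn_integral_completion add.commute)
qed

text \<open>The union in the definition of \<^const>\<open>ess_supp\<close> may be uncountable; by Lindelof's theorem countably
  many of its members cover it, and countably many null sets form a null set.\<close>

lemma AE_zero_outside_ess_supp:
  "AE \<xi> in lebesgue. \<xi> \<notin> ess_supp g \<longrightarrow> g \<xi> = 0"
proof -
  let ?\<U> = "{U. open U \<and> (AE \<xi> in lebesgue. \<xi> \<in> U \<longrightarrow> g \<xi> = 0)}"
  obtain \<V> where \<V>: "\<V> \<subseteq> ?\<U>" "countable \<V>" "\<Union>\<V> = \<Union>?\<U>"
    using Lindelof[of ?\<U>] by auto
  have "AE \<xi> in lebesgue. \<forall>U\<in>\<V>. \<xi> \<in> U \<longrightarrow> g \<xi> = 0"
    using \<V>(1) by (intro AE_ball_countable[OF \<V>(2), THEN iffD2]) auto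
  then show ?thesis
  proof eventually_elim
    case (elim \<xi>)
    have "- ess_supp g = \<Union>\<V>"
      by (simp only: \<V>(3) ess_supp_def double_compl)
    then show ?case
      using elim by blast
  qed
qed

text \<open>By definition \<^const>\<open>fourier\<close> is either a limit in the mean, to which \<open>L2_fourier_bound\<close>
  applies, or its default value \<open>0\<close>, for which both claims are trivial.\<close>

lemma fourier_measurable_and_bound:
  assumes f: "f \<in> L2"
  shows "fourier f \<in> borel_measurable lebesgue"
    and "(\<integral>\<^sup>+\<xi>. ennreal ((norm (fourier f \<xi>))\<^sup>2) \<partial>lborel)
      \<le> ennreal (2 / (2 * pi)\<^sup>2) * (\<integral>\<^sup>+x. ennreal ((norm (f x))\<^sup>2) \<partial>lborel)"
proof -
  have cases: "is_L2_fourier f (fourier f) \<or> fourier f = (\<lambda>_. 0)"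
    by (cases "\<exists>g. is_L2_fourier f g") (simp_all add: fourier_def someI_ex)
  show "fourier f \<in> borel_measurable lebesgue"
    using cases by (auto simp: is_L2_fourier_def L2_def)
  show "(\<integral>\<^sup>+\<xi>. ennreal ((norm (fourier f \<xi>))\<^sup>2) \<partial>lborel)
      \<le> ennreal (2 / (2 * pi)\<^sup>2) * (\<integral>\<^sup>+x. ennreal ((norm (f x))\<^sup>2) \<partial>lborel)"
    using cases by (elim disjE) (erule L2_fourier_bound[OF f], simp)
qed

section \<open>The maximal estimate\<close>

lemma schroedinger_eq_fourier_synthesis:
  assumes [measurable]: "g \<in> borel_measurable borel" "fourier f \<in> borel_measurable lebesgue"
    and ae: "AE \<xi> in lborel. fourier f \<xi> = g \<xi>"
  shows "schroedinger t f x = fourier_synthesis (evolve (\<lambda>\<xi>. \<xi>$1 * \<xi>$2) g t) x"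
proof -
  let ?e = "\<lambda>\<xi>::real^2. exp (\<i> * (x \<bullet> \<xi> + t * (\<xi>$1) * (\<xi>$2)))"
  have [measurable]: "?e \<in> borel_measurable borel" by measurable
  have [measurable]: "?e \<in> borel_measurable lebesgue" "g \<in> borel_measurable lebesgue"
    by (intro measurable_completion; measurable)+
  have "schroedinger t f x = (\<integral>\<xi>. ?e \<xi> * g \<xi> \<partial>lebesgue)"
    unfolding schroedinger_def
  proof (rule integral_cong_AE)
    show "AE \<xi> in lebesgue. ?e \<xi> * fourier f \<xi> = ?e \<xi> * g \<xi>"
      using AE_completion[OF ae] by eventually_elim simp
  qed measurable
  also have "\<dots> = (\<integral>\<xi>. ?e \<xi> * g \<xi> \<partial>lborel)"
    by (rule integral_completion) measurable
  also have "\<dots> = fourier_synthesis (evolve (\<lambda>\<xi>. \<xi>$1 * \<xi>$2) g t) x"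
    unfolding fourier_synthesis_def
  proof (rule Bochner_Integration.integral_cong[OF refl])
    fix \<xi> :: "real^2"
    have "?e \<xi> = iexp (x \<bullet> \<xi>) * iexp (t * (\<xi>$1 * \<xi>$2))"
      unfolding exp_add[symmetric] by (simp add: algebra_simps)
    then show "?e \<xi> * g \<xi> = iexp (x \<bullet> \<xi>) * evolve (\<lambda>\<xi>. \<xi>$1 * \<xi>$2) g t \<xi>"
      unfolding evolve_def by (simp only: mult.assoc)
  qed
  finally show ?thesis .
qed

lemma abs_prod_components_le: "\<bar>\<xi>$1 * \<xi>$2\<bar> \<le> (norm \<xi>)\<^sup>2 / 2" for \<xi> :: "real^2"
proof -
  have "(norm \<xi>)\<^sup>2 = (\<xi>$1)\<^sup>2 + (\<xi>$2)\<^sup>2"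
    by (simp only: power2_norm_eq_inner) (simp add: inner_vec_def sum_2 power2_eq_square)
  then show ?thesis
    using zero_le_power2[of "\<bar>\<xi>$1\<bar> - \<bar>\<xi>$2\<bar>"] by (simp add: power2_diff abs_mult)
qed

lemma schroedinger_maximal:
  assumes f: "f \<in> L2" and supp: "ess_supp (fourier f) \<subseteq> cball 0 \<rho>" and \<rho>: "0 < \<rho>"
    and I: "is_interval I" "I \<noteq> {}"
  shows "(\<integral>\<^sup>+x. (SUP t\<in>I. ennreal (norm (schroedinger t f x)))\<^sup>2 \<partial>lborel)
    \<le> (1 + ennreal (\<rho>\<^sup>2) * emeasure lborel I) * (2 * (\<integral>\<^sup>+x. ennreal ((norm (f x))\<^sup>2) \<partial>lborel))"
proof -
  let ?\<phi> = "\<lambda>\<xi>::real^2. \<xi>$1 * \<xi>$2" and ?q = "\<integral>\<^sup>+x. ennreal ((norm (f x))\<^sup>2) \<partial>lborel"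
  note four = fourier_measurable_and_bound[OF f]
  obtain g0 where g0 [measurable]: "g0 \<in> borel_measurable borel" and ae0: "AE \<xi> in lborel. fourier f \<xi> = g0 \<xi>"
    using lebesgue_measurable_ex_borel_complex[OF four(1)] .
  \<comment> \<open>Cutting off makes the phase bound hold at every frequency where \<open>g\<close> does not vanish, not just almost everywhere.\<close>
  define g where "g = (\<lambda>\<xi>. indicator (cball 0 \<rho>) \<xi> * g0 \<xi>)"
  have [measurable]: "cball (0 :: real^2) \<rho> \<in> sets borel" by simp
  have [measurable]: "g \<in> borel_measurable borel" unfolding g_def by measurable
  have "AE \<xi> in lborel. \<xi> \<notin> ess_supp (fourier f) \<longrightarrow> fourier f \<xi> = 0"
    using AE_zero_outside_ess_supp[of "fourier f"] by (simp add: AE_completion_iff)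
  with ae0 have ae: "AE \<xi> in lborel. fourier f \<xi> = g \<xi>"
    by eventually_elim (use supp in \<open>auto simp: g_def indicator_def\<close>)
  have g_le: "(\<integral>\<^sup>+\<xi>. ennreal ((norm (g \<xi>))\<^sup>2) \<partial>lborel) \<le> ennreal (2 / (2 * pi)\<^sup>2) * ?q"
  proof -
    have "(\<integral>\<^sup>+\<xi>. ennreal ((norm (g \<xi>))\<^sup>2) \<partial>lborel) = (\<integral>\<^sup>+\<xi>. ennreal ((norm (fourier f \<xi>))\<^sup>2) \<partial>lborel)"
      using ae by (intro nn_integral_cong_AE) auto
    then show ?thesis using four(2) by simp
  qed
  also have "\<dots> < \<infinity>"
    using f by (simp add: L2_iff ennreal_mult_less_top)
  finally have g_int: "integrable lborel g"
    by (intro integrable_bounded_support[where R = \<rho>]) (auto simp: g_def)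
  have bound: "\<bar>?\<phi> \<xi>\<bar> \<le> \<rho>\<^sup>2 / 2" if "g \<xi> \<noteq> 0" for \<xi>
  proof -
    have "norm \<xi> \<le> \<rho>" using that by (auto simp: g_def indicator_def split: if_splits)
    then have "(norm \<xi>)\<^sup>2 \<le> \<rho>\<^sup>2" by (intro power_mono) auto
    then show ?thesis using abs_prod_components_le[of \<xi>] by linarith
  qed
  have eq: "schroedinger t f x = fourier_synthesis (evolve ?\<phi> g t) x" for t x
    by (rule schroedinger_eq_fourier_synthesis[OF _ four(1) ae]) measurable
  have "(\<integral>\<^sup>+x. (SUP t\<in>I. ennreal (norm (schroedinger t f x)))\<^sup>2 \<partial>lborel)
      \<le> (1 + 2 * ennreal (\<rho>\<^sup>2 / 2) * emeasure lborel I)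
        * (ennreal ((2 * pi) ^ DIM(real^2)) * (\<integral>\<^sup>+\<xi>. ennreal ((norm (g \<xi>))\<^sup>2) \<partial>lborel))"
    unfolding eq using \<rho> by (intro maximal_inequality g_int bound I) auto
  also have "\<dots> \<le> (1 + 2 * ennreal (\<rho>\<^sup>2 / 2) * emeasure lborel I)
        * (ennreal ((2 * pi) ^ DIM(real^2)) * (ennreal (2 / (2 * pi)\<^sup>2) * ?q))"
    by (intro mult_left_mono g_le) auto
  also have "ennreal ((2 * pi) ^ DIM(real^2)) * (ennreal (2 / (2 * pi)\<^sup>2) * ?q) = 2 * ?q"
    unfolding mult.assoc[symmetric] ennreal_numeral[symmetric]
    by (subst ennreal_mult[symmetric]) auto
  also have "2 * ennreal (\<rho>\<^sup>2 / 2) = ennreal (\<rho>\<^sup>2)"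
    unfolding ennreal_numeral[symmetric] by (subst ennreal_mult[symmetric]) auto
  finally show ?thesis .
qed

theorem theorem1p2:
  fixes c1 c2 :: real
  assumes "0 < c1" and "c1 < c2"
  shows "\<exists>C>0. \<forall>(lam::real) (f :: real^2 \<Rightarrow> complex) (I :: real set).
           lam \<ge> 1 \<longrightarrow>
           f \<in> L2 \<longrightarrow>
           ess_supp (fourier f) \<subseteq> {\<xi>. c1 * lam \<le> norm \<xi> \<and> norm \<xi> \<le> c2 * lam} \<longrightarrow>
           is_interval I \<longrightarrow>
           1 / lam\<^sup>2 \<le> measure lebesgue I \<longrightarrow>
           measure lebesgue I \<le> 1 / lam \<longrightarrow>
           L2norm (lebesgue_on (ball 0 1)) (\<lambda>x. SUP t\<in>I. ennreal (norm (schroedinger t f x)))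
             \<le> ennreal (C * lam * sqrt (measure lebesgue I)) *
               L2norm lebesgue (\<lambda>x. ennreal (norm (f x)))"
proof (intro exI[of _ "sqrt (2 * (1 + c2\<^sup>2))"] conjI allI impI)
  show "0 < sqrt (2 * (1 + c2\<^sup>2))"
    by (intro real_sqrt_gt_zero mult_pos_pos add_pos_nonneg) auto
next
  fix lam :: real and f :: "real^2 \<Rightarrow> complex" and I :: "real set"
  assume lam: "lam \<ge> 1" and f: "f \<in> L2"
    and supp: "ess_supp (fourier f) \<subseteq> {\<xi>. c1 * lam \<le> norm \<xi> \<and> norm \<xi> \<le> c2 * lam}"
    and I: "is_interval I" and I_lower: "1 / lam\<^sup>2 \<le> measure lebesgue I"
  define m where "m = measure lebesgue I"
  let ?S = "\<lambda>x. SUP t\<in>I. ennreal (norm (schroedinger t f x))"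
    and ?q = "\<integral>\<^sup>+x. ennreal ((norm (f x))\<^sup>2) \<partial>lborel"
  have "0 < 1 / lam\<^sup>2" using lam by simp
  then have m: "0 < m" "1 \<le> lam\<^sup>2 * m"
    using less_le_trans[OF _ I_lower] I_lower lam by (auto simp: m_def field_simps)
  have I_borel: "I \<in> sets borel" by (rule real_interval_borel_measurable[OF I])
  have "I \<noteq> {}" using m(1) by (auto simp: m_def)
  \<comment> \<open>As \<^const>\<open>measure\<close> is \<open>0\<close> on sets of infinite measure, positivity of \<open>m\<close> excludes these.\<close>
  have I_meas: "emeasure lborel I = ennreal m"
  proof -
    have "measure lborel I = m" using I_borel by (simp add: m_def)
    moreover from this have "emeasure lborel I \<noteq> \<infinity>" using m(1) by (auto simp: measure_def)
    ultimately show ?thesis by (simp add: emeasure_eq_ennreal_measure)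
  qed
  \<comment> \<open>The lower bound on the length of \<open>I\<close> absorbs the \<open>1\<close>, which stems from the fixed time. The square of
    the final constant is \<open>1 + c2\<^sup>2\<close> times the factor \<open>2\<close> of \<open>schroedinger_maximal\<close>.\<close>
  have const: "1 + (c2 * lam)\<^sup>2 * m \<le> (1 + c2\<^sup>2) * (lam\<^sup>2 * m)"
    using m(2) by (simp add: algebra_simps power_mult_distrib)
  have "(\<integral>\<^sup>+x. (?S x)\<^sup>2 \<partial>lebesgue_on (ball 0 1)) \<le> (\<integral>\<^sup>+x. (?S x)\<^sup>2 \<partial>lborel)"
  proof -
    have "(\<integral>\<^sup>+x. (?S x)\<^sup>2 \<partial>lebesgue_on (ball 0 1)) = (\<integral>\<^sup>+x. (?S x)\<^sup>2 * indicator (ball 0 1) x \<partial>lebesgue)"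
      by (rule nn_integral_restrict_space) simp
    also have "\<dots> \<le> (\<integral>\<^sup>+x. (?S x)\<^sup>2 \<partial>lebesgue)"
      by (intro nn_integral_mono) (simp add: indicator_def)
    finally show ?thesis by (simp only: nn_integral_completion)
  qed
  also have "\<dots> \<le> (1 + ennreal ((c2 * lam)\<^sup>2) * emeasure lborel I) * (2 * ?q)"
    using supp assms lam by (intro schroedinger_maximal f I \<open>I \<noteq> {}\<close>) (auto intro: mult_pos_pos)
  also have "(1 + ennreal ((c2 * lam)\<^sup>2) * emeasure lborel I) = ennreal (1 + (c2 * lam)\<^sup>2 * m)"
    using m(1) by (simp add: I_meas ennreal_mult)
  also have "ennreal (1 + (c2 * lam)\<^sup>2 * m) * (2 * ?q) \<le> ennreal ((1 + c2\<^sup>2) * (lam\<^sup>2 * m)) * (2 * ?q)"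
    by (intro mult_right_mono ennreal_leI const) simp
  also have "\<dots> = ennreal ((sqrt (2 * (1 + c2\<^sup>2)) * lam * sqrt m)\<^sup>2) * ?q"
  proof -
    have "(sqrt (2 * (1 + c2\<^sup>2)) * lam * sqrt m)\<^sup>2 = (1 + c2\<^sup>2) * (lam\<^sup>2 * m) * 2"
      using m(1) by (simp add: power_mult_distrib real_sqrt_pow2)
    then show ?thesis
      using m(1) by (simp only:) (simp add: ennreal_mult mult.assoc)
  qed
  also have "\<dots> = (ennreal (sqrt (2 * (1 + c2\<^sup>2)) * lam * sqrt m))\<^sup>2 * (\<integral>\<^sup>+x. (ennreal (norm (f x)))\<^sup>2 \<partial>lebesgue)"
    using m(1) lam by (simp add: nn_integral_completion ennreal_power)
  finally show "L2norm (lebesgue_on (ball 0 1)) ?S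
      \<le> ennreal (sqrt (2 * (1 + c2\<^sup>2)) * lam * sqrt (measure lebesgue I)) * L2norm lebesgue (\<lambda>x. ennreal (norm (f x)))"
    unfolding m_def by (rule L2norm_le_L2norm)
qed

end
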